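(* Let $p$ be an odd prime and let $G$ be a finite $p$-group of nilpotency class $5$. Then $\exp(M(G))$ divides $\exp(G)$, where $M(G)=H_2(G,\mathbb{Z})$ is the Schur multiplier of $G$.
   Context: $\exp(X)$ denotes the exponent of a group $X$. The Schur multiplier $M(G)$ is the second integral homology group $H_2(G,\mathbb{Z})$. *)

theory Defs
  imports "HOL-Algebra.Algebra"
begin

definition group_exponent :: "('a, 'b) monoid_scheme \<Rightarrow> nat" where
  "group_exponent H =
     (if \<exists>n::nat>0. \<forall>x\<in>carrier H. x [^]\<^bsub>H\<^esub> n = \<one>\<^bsub>H\<^esub>
      then (LEAST n::nat. n > 0 \<and> (\<forall>x\<in>carrier H. x [^]\<^bsub>H\<^esub> n = \<one>\<^bsub>H\<^esub>))
      else 0)"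

definition p_group :: "nat \<Rightarrow> ('a, 'b) monoid_scheme \<Rightarrow> bool" where
  "p_group p G \<longleftrightarrow> group G \<and> finite (carrier G) \<and> (\<exists>k. card (carrier G) = p ^ k)"

text \<open>Lower central series: lcs G 0 = G = gamma_1, lcs G (Suc n) = [lcs G n, G].\<close>
fun lower_central :: "('a, 'b) monoid_scheme \<Rightarrow> nat \<Rightarrow> 'a set" where
  "lower_central G 0 = carrier G"
| "lower_central G (Suc n) =
     generate G {x \<otimes>\<^bsub>G\<^esub> y \<otimes>\<^bsub>G\<^esub> inv\<^bsub>G\<^esub> x \<otimes>\<^bsub>G\<^esub> inv\<^bsub>G\<^esub> y | x y.
                 x \<in> lower_central G n \<and> y \<in> carrier G}"

definition nilpotency_class :: "('a, 'b) monoid_scheme \<Rightarrow> nat \<Rightarrow> bool" where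
  "nilpotency_class G c \<longleftrightarrow>
     lower_central G c = {\<one>\<^bsub>G\<^esub>} \<and>
     (\<forall>k<c. lower_central G k \<noteq> {\<one>\<^bsub>G\<^esub>})"

text \<open>n-chains: integer combinations of n-tuples (lists of length n) of group elements.\<close>
definition bar_basis :: "('a, 'b) monoid_scheme \<Rightarrow> nat \<Rightarrow> 'a list set" where
  "bar_basis G n = {xs. length xs = n \<and> set xs \<subseteq> carrier G}"

definition chains :: "('a, 'b) monoid_scheme \<Rightarrow> nat \<Rightarrow> ('a list \<Rightarrow> int) set" where
  "chains G n = {c. \<forall>ys. ys \<notin> bar_basis G n \<longrightarrow> c ys = 0}"

definition basis_vec :: "'a list \<Rightarrow> 'a list \<Rightarrow> int" where
  "basis_vec xs = (\<lambda>ys. if ys = xs then 1 else 0)"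

text \<open>Bar differential with trivial coefficients Z:
  d[g1..gn] = [g2..gn] + sum_{i=1}^{n-1} (-1)^i [g1..g_i g_{i+1}..gn] + (-1)^n [g1..g_{n-1}].\<close>
definition bar_bd :: "('a, 'b) monoid_scheme \<Rightarrow> nat \<Rightarrow> 'a list \<Rightarrow> 'a list \<Rightarrow> int" where
  "bar_bd G n xs = (\<lambda>ys.
      basis_vec (tl xs) ys
    + (\<Sum>i\<in>{1..<n}. (-1) ^ i *
         basis_vec (take (i - 1) xs @ [xs ! (i - 1) \<otimes>\<^bsub>G\<^esub> xs ! i] @ drop (i + 1) xs) ys)
    + (-1) ^ n * basis_vec (butlast xs) ys)"

definition boundary :: "('a, 'b) monoid_scheme \<Rightarrow> nat \<Rightarrow> ('a list \<Rightarrow> int) \<Rightarrow> 'a list \<Rightarrow> int" where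
  "boundary G n c = (\<lambda>ys. \<Sum>xs\<in>bar_basis G n. c xs * bar_bd G n xs ys)"

definition cycles :: "('a, 'b) monoid_scheme \<Rightarrow> nat \<Rightarrow> ('a list \<Rightarrow> int) set" where
  "cycles G n = {c \<in> chains G n. boundary G n c = (\<lambda>_. 0)}"

definition boundaries :: "('a, 'b) monoid_scheme \<Rightarrow> nat \<Rightarrow> ('a list \<Rightarrow> int) set" where
  "boundaries G n = boundary G (Suc n) ` chains G (Suc n)"

definition cycle_group :: "('a, 'b) monoid_scheme \<Rightarrow> nat \<Rightarrow> ('a list \<Rightarrow> int) monoid" where
  "cycle_group G n = \<lparr>carrier = cycles G n, monoid.mult = (\<lambda>f g. (\<lambda>x. f x + g x)),
                      one = (\<lambda>_. 0)\<rparr>"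

definition group_homology :: "('a, 'b) monoid_scheme \<Rightarrow> nat \<Rightarrow> ('a list \<Rightarrow> int) set monoid" where
  "group_homology G n = cycle_group G n Mod boundaries G n"

definition schur_multiplier :: "('a, 'b) monoid_scheme \<Rightarrow> ('a list \<Rightarrow> int) set monoid" where
  "schur_multiplier G = group_homology G 2"

end

theory Submission
  imports Defs "HOL-Library.Function_Algebras"
begin

text \<open>
  The 2-chains modulo boundaries carry the universal 2-cocycle [g,h] and define a central extension
  H of G in which the 2-cycles land in the derived subgroup. So it suffices to show that if H has
  class at most 6 and all e-th powers are central, where e = exp G is a power of p, then e kills the
  derived subgroup of H.

  Powers of products are expanded by a Hall--Petrescu formula, in which the only binomial
  coefficient not divisible by e is r = (e choose p), for p = 3 or p = 5. The remaining terms are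
  r-th powers of (p - 1)-fold commutators with x. For p = 3, an Engel argument shows that r kills
  the fifth term of the lower central series. Then e [y,x] + r [x,...,x,[y,x]] = 0 for all x and y,
  with p - 1 outer entries x, and the r-th power is multilinear. Replacing (x,y) by (y + n x, x)
  leaves [y,x] unchanged up to sign, so the second summand is a constant polynomial in n; its
  leading term (p - 1)! r [x,...,x,[y,x]] vanishes, and (p - 1)! is prime to p.
\<close>

section \<open>Commutators and subgroups in additive notation\<close>

text \<open>All relations come from one observation: the conjugate \<open>y + x - y\<close> equals
  \<open>commutator y x + x\<close>, and centrality gives it the same \<open>e\<close>-th multiple
  as \<open>x\<close>, so the other terms of the expansion add up to 0. Its k-th term involves an
  element of \<open>gam H (k + 1)\<close>, hence only k < 6 counts, and for p >= 7 no multiple of p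
  occurs there. The obstacle is that multiplication by \<open>r\<close> is not additive, while the
  coefficient next to \<open>r\<close> is known only up to the next lower central term. For p = 5
  its leading part lies in \<open>gam H 6\<close>, where nothing deeper is left. For p = 3 it lies
  in \<open>gam H 4\<close>, so \<open>gam H 6\<close> and then \<open>gam H 5\<close> have to be
  disposed of first. There the same expansion, taken with an arbitrary z in \<open>gam H 2\<close>,
  shows that \<open>r\<close> times some d congruent to [x,[x,z]] is central; bracketing with
  further elements turns this into the Engel condition. Groups are modelled as types because
  sequences \<open>nat \<Rightarrow> 'g\<close> then form a group under pointwise operations, and
  every commutator identity applies to them verbatim.\<close>

declare add_uminus_conv_diff [simp del]

lemmas group_simps = diff_conv_add_uminus add.assoc minus_add

definition commutator :: "'g::group_add \<Rightarrow> 'g \<Rightarrow> 'g" where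
  "commutator x y = x + y - x - y"

primrec mul :: "nat \<Rightarrow> 'g::monoid_add \<Rightarrow> 'g" where
  "mul 0 x = 0"
| "mul (Suc n) x = x + mul n x"

definition subgrp :: "'g::group_add set \<Rightarrow> bool" where
  "subgrp S \<longleftrightarrow> 0 \<in> S \<and> (\<forall>x\<in>S. \<forall>y\<in>S. x + y \<in> S) \<and> (\<forall>x\<in>S. - x \<in> S)"

inductive_set gen_by :: "'g::group_add set \<Rightarrow> 'g set" for S where
  gen_zero: "0 \<in> gen_by S"
| gen_base: "x \<in> S \<Longrightarrow> x \<in> gen_by S"
| gen_add: "x \<in> gen_by S \<Longrightarrow> y \<in> gen_by S \<Longrightarrow> x + y \<in> gen_by S"
| gen_uminus: "x \<in> gen_by S \<Longrightarrow> - x \<in> gen_by S"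

lemma sum_list_eq_0: "(\<And>k. k \<in> set ks \<Longrightarrow> f k = (0::'g::monoid_add)) \<Longrightarrow> (\<Sum>k\<leftarrow>ks. f k) = 0"
  by (induction ks) auto

lemma mul_1 [simp]: "mul (Suc 0) x = x" by simp

lemma mul_zero [simp]: "mul n 0 = 0" by (induction n) auto

lemma mul_add: "mul (m + n) x = mul m x + mul n x"
  by (induction m) (auto simp: add.assoc)

lemma mul_mult: "mul (m * n) x = mul m (mul n x)"
  by (induction m) (auto simp: mul_add)

lemma mul_Suc2: "mul (Suc n) x = mul n x + x"
  using mul_add[of n 1 x] by simp

lemma commutes_mul: "x + y = y + x \<Longrightarrow> mul n x + y = y + mul n x"
  by (induction n) (auto simp: add.assoc, metis add.assoc)

lemma mul_add_commute: "x + y = y + x \<Longrightarrow> mul n (x + y) = mul n x + mul n y"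
proof (induction n)
  case (Suc n)
  have "mul n x + y = y + mul n x" using Suc.prems by (rule commutes_mul)
  then have "mul n x + (y + mul n y) = y + (mul n x + mul n y)" by (metis add.assoc)
  moreover have "mul n (x + y) = mul n x + mul n y" using Suc by blast
  ultimately show ?case by (simp only: mul.simps add.assoc)
qed simp

lemma mul_uminus: "mul n (- x) = - mul n (x::'g::group_add)"
proof -
  have "mul n x + mul n (- x) = 0"
    using mul_add_commute[of x "- x" n] by simp
  then show ?thesis by (simp add: eq_neg_iff_add_eq_0 minus_unique)
qed

lemma mul_conj: "mul n (g + x - g) = g + mul n x - (g::'g::group_add)"
  by (induction n) (auto simp: group_simps)

lemma subgrpD:
  assumes "subgrp S"
  shows subgrp_zero: "0 \<in> S"
    and subgrp_add: "x \<in> S \<Longrightarrow> y \<in> S \<Longrightarrow> x + y \<in> S"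
    and subgrp_uminus: "x \<in> S \<Longrightarrow> - x \<in> S"
    and subgrp_diff: "x \<in> S \<Longrightarrow> y \<in> S \<Longrightarrow> x - y \<in> S"
  using assms unfolding subgrp_def
  by (blast, blast, blast, metis diff_conv_add_uminus)

lemma subgrp_mul: "subgrp S \<Longrightarrow> x \<in> S \<Longrightarrow> mul n x \<in> S"
  by (induction n) (auto intro: subgrpD)

lemma subgrp_commutator: "subgrp S \<Longrightarrow> x \<in> S \<Longrightarrow> y \<in> S \<Longrightarrow> commutator x y \<in> S"
  unfolding commutator_def by (intro subgrpD) auto

lemma subgrp_gen_by: "subgrp (gen_by S)"
  unfolding subgrp_def by (auto intro: gen_by.intros)

lemma gen_by_least:
  assumes "subgrp T" "S \<subseteq> T" shows "gen_by S \<subseteq> T"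
proof
  fix x assume "x \<in> gen_by S"
  then show "x \<in> T" by induction (use assms in \<open>auto intro: subgrpD\<close>)
qed

lemma commutator_zero [simp]: "commutator 0 x = 0" "commutator x 0 = 0"
  by (auto simp: commutator_def)

lemma uminus_commutator: "- commutator x y = commutator y x"
  by (simp add: commutator_def group_simps)

lemma conj_eq_commutator: "g + x - g = commutator g x + x"
  by (simp add: commutator_def group_simps)

lemma commutator_eq_0_iff: "commutator x y = 0 \<longleftrightarrow> x + y = y + x"
  unfolding commutator_def by (metis add_diff_cancel diff_add_cancel diff_eq_eq eq_iff_diff_eq_0)

lemma commutator_add_left: "commutator (x + y) z = x + commutator y z - x + commutator x z"
  by (simp add: commutator_def group_simps)

lemma commutator_add_right: "commutator x (y + z) = commutator x y + (y + commutator x z - y)"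
  by (simp add: commutator_def group_simps)

lemma hall_witt:
  "commutator (commutator x y) (y + z - y) + commutator (commutator y z) (z + x - z)
     + commutator (commutator z x) (x + y - x) = 0"
  by (simp add: commutator_def group_simps)

section \<open>Polynomial sequences in a filtered group\<close>

definition fdiff :: "(nat \<Rightarrow> 'g::group_add) \<Rightarrow> nat \<Rightarrow> 'g" where
  "fdiff g = (\<lambda>n. g (Suc n) - g n)"

lemma fdiff_add: "fdiff (f + g) = fdiff f + commutator f (fdiff g) + fdiff g"
  by (rule ext) (simp add: fdiff_def commutator_def group_simps fun_diff_def)

lemma fdiff_uminus: "fdiff (- f) = - f + (- fdiff f) - (- f)"
  by (rule ext) (simp add: fdiff_def commutator_def group_simps fun_diff_def)

lemma fdiff_commutator:
  "fdiff (commutator f g) =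
     (fdiff f + commutator f (fdiff g) - fdiff f)
     + ((fdiff f + fdiff g) + commutator f g - (fdiff f + fdiff g))
     + commutator (fdiff f) (fdiff g + g) - commutator f g"
  by (rule ext) (simp add: fdiff_def commutator_def group_simps fun_diff_def)

lemma fdiff_0 [simp]: "fdiff (\<lambda>n. 0) = (\<lambda>n. 0)"
  by (rule ext) (simp add: fdiff_def)

lemma funpow_fdiff_0 [simp]: "(fdiff ^^ k) (\<lambda>n. 0) = (\<lambda>n. 0)"
  by (induction k) auto

text \<open>The surplus \<open>\<delta>\<close> allows an index that differs from the commutator
  weight. With \<open>F k = gam H (Suc k)\<close> one can take \<open>\<delta> = 1\<close>, and
  exactly this surplus determines expansion coefficients modulo the next term.\<close>

locale filtered =
  fixes F :: "nat \<Rightarrow> 'g::group_add set" and \<delta> :: nat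
  assumes F_sub: "subgrp (F i)"
    and F_Suc: "F (Suc i) \<subseteq> F i"
    and F_comm: "x \<in> F i \<Longrightarrow> y \<in> F j \<Longrightarrow> commutator x y \<in> F (i + j + \<delta>)"
begin

lemma F_mono: "i \<le> j \<Longrightarrow> F j \<subseteq> F i"
  using lift_Suc_antimono_le[of F] F_Suc by blast

text \<open>If fdiff raises the index of the generators B, then it raises the index of everything they
  generate, so the closure of B consists of polynomial sequences. Applied to the polynomial sequences
  themselves, this is the Lazard--Leibman theorem that they form a filtered group.\<close>
inductive closure :: "(nat \<Rightarrow> (nat \<Rightarrow> 'g) set) \<Rightarrow> nat \<Rightarrow> (nat \<Rightarrow> 'g) \<Rightarrow> bool" for B where
  base: "g \<in> B i \<Longrightarrow> closure B i g"
| zero: "closure B i 0"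
| add: "closure B i f \<Longrightarrow> closure B i g \<Longrightarrow> closure B i (f + g)"
| uminus: "closure B i f \<Longrightarrow> closure B i (- f)"
| comm: "closure B i f \<Longrightarrow> closure B j g \<Longrightarrow> closure B (i + j + \<delta>) (commutator f g)"
| down: "closure B (Suc i) f \<Longrightarrow> closure B i f"

definition poly :: "nat \<Rightarrow> (nat \<Rightarrow> 'g) set" where
  "poly i = {g. \<forall>k n. (fdiff ^^ k) g n \<in> F (i + k)}"

lemma closure_antimono: "i \<le> j \<Longrightarrow> closure B j f \<Longrightarrow> closure B i f"
  by (induction rule: dec_induct) (auto intro: closure.down)

lemma closure_comm_le:
  "closure B i f \<Longrightarrow> closure B j g \<Longrightarrow> k \<le> i + j + \<delta> \<Longrightarrow> closure B k (commutator f g)"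
  using closure.comm closure_antimono by blast

lemma closure_conj: "closure B i f \<Longrightarrow> closure B j g \<Longrightarrow> closure B i (g + f - g)"
  unfolding conj_eq_commutator by (intro closure.add closure_comm_le) auto

lemma closure_value:
  assumes "\<And>i g n. g \<in> B i \<Longrightarrow> g n \<in> F i"
  shows "closure B i g \<Longrightarrow> g n \<in> F i"
proof (induction rule: closure.induct)
  case (comm i f j g)
  then show ?case using F_comm[of "f n" i "g n" j] by (simp add: commutator_def)
next
  case (down i f)
  then show ?case using F_Suc by blast
qed (use assms in \<open>auto intro: subgrpD[OF F_sub]\<close>)

lemma closure_fdiff:
  assumes "\<And>i g. g \<in> B i \<Longrightarrow> closure B (Suc i) (fdiff g)"
  shows "closure B i g \<Longrightarrow> closure B (Suc i) (fdiff g)"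
proof (induction rule: closure.induct)
  case (base g i)
  then show ?case using assms by blast
next
  case (zero i)
  show ?case using closure.zero[of B "Suc i"] by (simp add: zero_fun_def)
next
  case (add i f g)
  show ?case unfolding fdiff_add
    by (intro closure.add closure_comm_le[OF add.hyps(1) add.IH(2)] add.IH) simp
next
  case (uminus i f)
  show ?case unfolding fdiff_uminus
    by (intro closure_conj[of _ _ _ i] closure.uminus uminus)
next
  case (comm i f j g)
  let ?m = "Suc (i + j + \<delta>)" and ?X = "commutator f g"
  have X: "closure B (i + j + \<delta>) ?X" by (intro closure.comm comm)
  let ?u = "fdiff f + fdiff g"
  have u: "closure B (Suc 0) ?u"
    by (intro closure.add closure_antimono[OF _ comm.IH(1)] closure_antimono[OF _ comm.IH(2)]) auto
  have 1: "closure B ?m (fdiff f + commutator f (fdiff g) - fdiff f)"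
    by (intro closure_conj[OF _ comm.IH(1)] closure_comm_le[OF comm.hyps(1) comm.IH(2)]) simp
  have 2: "closure B ?m (commutator ?u ?X)"
    by (intro closure_comm_le[OF u X]) simp
  have 3: "closure B ?m (commutator (fdiff f) (fdiff g + g))"
    by (rule closure_comm_le[OF comm.IH(1) closure.add[OF closure.down[OF comm.IH(2)] comm.hyps(2)]]) simp
  \<comment> \<open>The stray copies of \<open>?X\<close>, whose index is one too low, are made to
    survive only inside the commutator with \<open>?u\<close> and as conjugators.\<close>
  have "fdiff ?X = (fdiff f + commutator f (fdiff g) - fdiff f) + (commutator ?u ?X
      + (?X + commutator (fdiff f) (fdiff g + g) - ?X))"
    unfolding fdiff_commutator conj_eq_commutator[of ?u] by (simp add: group_simps)
  then show ?case
    using closure.add[OF 1 closure.add[OF 2 closure_conj[OF 3 X]]] by (simp only:)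
next
  case (down i f)
  then show ?case by (blast intro: closure.down)
qed

lemma closure_imp_poly:
  assumes "\<And>i g n. g \<in> B i \<Longrightarrow> g n \<in> F i"
    and "\<And>i g. g \<in> B i \<Longrightarrow> closure B (Suc i) (fdiff g)"
    and "closure B i g"
  shows "g \<in> poly i"
proof -
  have "closure B (i + k) ((fdiff ^^ k) g)" for k
    by (induction k) (use assms(3) closure_fdiff[OF assms(2)] in auto)
  moreover have "h n \<in> F j" if "closure B j h" for h j n
    by (rule closure_value[OF _ that]) (rule assms(1))
  ultimately show ?thesis unfolding poly_def by blast
qed

lemma poly_value: "g \<in> poly i \<Longrightarrow> g n \<in> F i"
  unfolding poly_def using funpow_0 by (metis (mono_tags, lifting) add.right_neutral mem_Collect_eq)

lemma poly_fdiff: "g \<in> poly i \<Longrightarrow> fdiff g \<in> poly (Suc i)"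
  unfolding poly_def mem_Collect_eq by (metis add_Suc_shift comp_apply funpow_Suc_right)

lemma poly_funpow: "g \<in> poly i \<Longrightarrow> (fdiff ^^ k) g \<in> poly (i + k)"
  by (induction k) (auto dest: poly_fdiff)

lemma poly_closure: "closure poly i g \<Longrightarrow> g \<in> poly i"
  by (rule closure_imp_poly) (auto intro: poly_value closure.base poly_fdiff)

lemma poly_zero: "0 \<in> poly i"
  and poly_add: "f \<in> poly i \<Longrightarrow> g \<in> poly i \<Longrightarrow> f + g \<in> poly i"
  and poly_uminus: "f \<in> poly i \<Longrightarrow> - f \<in> poly i"
  and poly_comm: "f \<in> poly i \<Longrightarrow> g \<in> poly j \<Longrightarrow> commutator f g \<in> poly (i + j + \<delta>)"
  and poly_down: "f \<in> poly (Suc i) \<Longrightarrow> f \<in> poly i"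
  by (rule poly_closure; blast intro: closure.intros)+

lemma poly_antimono: "i \<le> j \<Longrightarrow> f \<in> poly j \<Longrightarrow> f \<in> poly i"
  by (induction rule: dec_induct) (auto intro: poly_down)

lemma poly_conj: "f \<in> poly i \<Longrightarrow> g \<in> poly j \<Longrightarrow> g + f - g \<in> poly i"
  by (rule poly_closure, rule closure_conj; rule closure.base)

text \<open>Differences fail to be additive by commutators. Passing to the next difference moves
  \<open>fdiff ?V\<close> across \<open>?U + w\<close>; the commutator created pairs index
  \<open>i + k\<close> with index \<open>i + Suc k\<close>, which is at least as deep as the new
  \<open>w\<close> has to be.\<close>

lemma funpow_fdiff_add:
  assumes "f \<in> poly i" "g \<in> poly i"
  shows "\<exists>w \<in> poly (i + k + \<delta>). (fdiff ^^ k) (f + g) = (fdiff ^^ k) f + w + (fdiff ^^ k) g"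
proof (induction k)
  case 0
  show ?case by (rule bexI[of _ 0]) (auto intro: poly_zero)
next
  case (Suc k)
  then obtain w where w: "w \<in> poly (i + k + \<delta>)"
    and eq: "(fdiff ^^ k) (f + g) = (fdiff ^^ k) f + w + (fdiff ^^ k) g" by blast
  let ?U = "(fdiff ^^ k) f" and ?V = "(fdiff ^^ k) g"
  have U: "?U \<in> poly (i + k)" and V: "?V \<in> poly (i + k)"
    using assms by (auto intro: poly_funpow)
  have "?U + w \<in> poly (i + k)" using poly_antimono[OF _ w] poly_add[OF U] by simp
  then have 1: "commutator (?U + w) (fdiff ?V) \<in> poly (i + Suc k + \<delta>)"
    by (rule poly_antimono[OF _ poly_comm[OF _ poly_fdiff[OF V]], rotated]) simp
  have 2: "?U + fdiff w - ?U \<in> poly (i + Suc k + \<delta>)"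
    using poly_conj[OF poly_fdiff[OF w] U] by simp
  have 3: "(fdiff ^^ Suc k) (f + g) =
     fdiff ?U + ((?U + fdiff w - ?U) + commutator (?U + w) (fdiff ?V)) + fdiff ?V"
    unfolding funpow.simps comp_apply eq
    by (simp add: fdiff_add commutator_def group_simps)
  show ?case
    using 3 poly_add[OF 2 1] by (metis comp_apply funpow.simps(2))
qed

section \<open>Newton expansion of polynomial sequences\<close>

lemma fdiff_binomial:
  "(fdiff ^^ k) (\<lambda>n. mul (n choose j) d) = (if k \<le> j then (\<lambda>n. mul (n choose (j - k)) d) else 0)"
proof (induction k)
  case (Suc k)
  show ?case
  proof (cases "k < j")
    case True
    then obtain i where i: "j - k = Suc i" "j - Suc k = i" by (metis Suc_diff_Suc)
    have "mul (Suc n choose Suc i) d - mul (n choose Suc i) d = mul (n choose i) d" for n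
      by (simp add: mul_add)
    then show ?thesis using Suc True i by (simp add: fdiff_def)
  qed (use Suc in \<open>auto simp: fdiff_def fun_eq_iff\<close>)
qed simp

lemma poly_binomial: "d \<in> F (i + j) \<Longrightarrow> (\<lambda>n. mul (n choose j) d) \<in> poly i"
  unfolding poly_def mem_Collect_eq fdiff_binomial
  using F_mono[of "i + _" "i + j"] by (auto intro!: subgrp_mul[OF F_sub] subgrp_zero[OF F_sub])

lemma fdiff_at_0: "(\<And>j. j < k \<Longrightarrow> g j = 0) \<Longrightarrow> (fdiff ^^ k) g 0 = g k"
proof -
  have "(\<And>j. j < k + l \<Longrightarrow> g j = 0) \<Longrightarrow> (fdiff ^^ k) g l = g (k + l)" for g l
  proof (induction k arbitrary: g)
    case (Suc k)
    have "fdiff g j = 0" if "j < k + l" for j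
      using that by (simp add: fdiff_def Suc.prems)
    from Suc.IH[OF this] have "(fdiff ^^ Suc k) g l = fdiff g (k + l)"
      by (simp add: funpow_swap1)
    also have "\<dots> = g (Suc k + l)" using Suc.prems by (simp add: fdiff_def)
    finally show ?case .
  qed simp
  from this[of 0 g] show "(\<And>j. j < k \<Longrightarrow> g j = 0) \<Longrightarrow> (fdiff ^^ k) g 0 = g k" by simp
qed

text \<open>The noncommutative form of the fact that a polynomial of degree below \<open>k\<close>
  with the roots 0, ..., k - 1 vanishes.\<close>

lemma fdiff_eq_0: "(fdiff ^^ k) g = 0 \<Longrightarrow> (\<And>j. j < k \<Longrightarrow> g j = 0) \<Longrightarrow> g = 0"
proof (induction k arbitrary: g)
  case (Suc k)
  have "fdiff g j = 0" if "j < k" for j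
    using that by (simp add: fdiff_def Suc.prems)
  then have "fdiff g = 0"
    using Suc.IH[of "fdiff g"] Suc.prems(1) unfolding funpow_Suc_right comp_apply by blast
  then have "g (Suc n) = g n" for n by (metis fdiff_def right_minus_eq zero_fun_apply)
  then have "g n = 0" for n using Suc.prems(2)[of 0] by (induction n) auto
  then show ?case by auto
qed simp

abbreviation binomial_sum :: "nat \<Rightarrow> (nat \<Rightarrow> 'g) \<Rightarrow> nat \<Rightarrow> 'g" where
  "binomial_sum m d n \<equiv> (\<Sum>k\<leftarrow>[0..<m]. mul (n choose k) (d k))"

text \<open>Newton interpolation: the next coefficient is the value at \<open>m\<close> of the
  remainder \<open>R\<close>, which vanishes before \<open>m\<close>, so that \<open>R m\<close> is
  also its \<open>m\<close>-th difference at 0. The bound on the \<open>m\<close>-th difference of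
  the partial sum is carried along to compare this value with the difference of \<open>g\<close>. At
  \<open>m = M\<close> the remainder has zero \<open>M\<close>-th difference and \<open>M\<close>
  zeros, hence is 0.\<close>

lemma taylor:
  assumes g: "g \<in> poly i" and M: "F (i + M) = {0}"
  obtains d where "\<And>k. k < M \<Longrightarrow> d k \<in> F (i + k)"
    "\<And>k. k < M \<Longrightarrow> d k - (fdiff ^^ k) g 0 \<in> F (i + k + \<delta>)"
    "\<And>n. g n = binomial_sum M d n"
proof -
  have "\<exists>d. (\<forall>k<m. d k \<in> F (i + k) \<and> d k - (fdiff ^^ k) g 0 \<in> F (i + k + \<delta>)) \<and>
      (\<forall>n<m. g n = binomial_sum m d n) \<and> binomial_sum m d \<in> poly i \<and>
      (fdiff ^^ m) (binomial_sum m d) \<in> poly (i + m + \<delta>)" for m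
  proof (induction m)
    case 0
    have "(fdiff ^^ 0) (binomial_sum 0 d) = 0" for d by (rule ext) simp
    then show ?case by (auto intro!: poly_zero simp: zero_fun_def[symmetric])
  next
    case (Suc m)
    then obtain d where d: "\<And>k. k < m \<Longrightarrow> d k \<in> F (i + k)"
      "\<And>k. k < m \<Longrightarrow> d k - (fdiff ^^ k) g 0 \<in> F (i + k + \<delta>)"
      "\<And>n. n < m \<Longrightarrow> g n = binomial_sum m d n" and T: "binomial_sum m d \<in> poly i"
      and DT: "(fdiff ^^ m) (binomial_sum m d) \<in> poly (i + m + \<delta>)" by blast
    let ?T = "binomial_sum m d"
    define R where "R = - ?T + g"
    have R: "R \<in> poly i" unfolding R_def by (intro poly_add poly_uminus T g)
    have R0: "R j = 0" if "j < m" for j using d(3)[OF that] by (simp add: R_def)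
    have Rm: "(fdiff ^^ m) R 0 = R m" by (rule fdiff_at_0) (rule R0)
    have RmF: "R m \<in> F (i + m)" using poly_value[OF poly_funpow[OF R, of m], of 0] Rm by simp
    define d' where "d' = d(m := R m)"
    have eq: "binomial_sum m d' n = ?T n" for n
      by (intro arg_cong[of _ _ sum_list] map_cong) (auto simp: d'_def)
    have eqS: "binomial_sum (Suc m) d' = ?T + (\<lambda>n. mul (n choose m) (R m))"
      using eq by (auto simp: fun_eq_iff d'_def)
    have b: "(\<lambda>n. mul (n choose m) (R m)) \<in> poly i" by (rule poly_binomial[OF RmF])
    obtain w where w: "w \<in> poly (i + m + \<delta>)" and "(fdiff ^^ m) (?T + R) = (fdiff ^^ m) ?T + w + (fdiff ^^ m) R"
      using funpow_fdiff_add[OF T R] by blast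
    moreover have "?T + R = g" by (simp add: R_def)
    ultimately have "(fdiff ^^ m) g = (fdiff ^^ m) ?T + w + (fdiff ^^ m) R" by simp
    then have "R m - (fdiff ^^ m) g 0 = - ((fdiff ^^ m) ?T 0 + w 0)"
      using Rm by (simp add: group_simps)
    moreover have "- ((fdiff ^^ m) ?T 0 + w 0) \<in> F (i + m + \<delta>)"
      by (intro subgrpD[OF F_sub] poly_value[OF DT] poly_value[OF w])
    ultimately have 1: "R m - (fdiff ^^ m) g 0 \<in> F (i + m + \<delta>)" by simp
    have 2: "g n = binomial_sum (Suc m) d' n" if "n < Suc m" for n
    proof (cases "n = m")
      case True
      have "binomial_sum (Suc m) d' m = ?T m + R m" using fun_cong[OF eqS, of m] by simp
      then show ?thesis using True by (simp add: R_def)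
    next
      case False
      then show ?thesis using that d(3)[of n] fun_cong[OF eqS, of n] by (simp add: binomial_eq_0)
    qed
    obtain w' where w': "w' \<in> poly (i + Suc m + \<delta>)"
      and "(fdiff ^^ Suc m) (binomial_sum (Suc m) d') =
        (fdiff ^^ Suc m) ?T + w' + (fdiff ^^ Suc m) (\<lambda>n. mul (n choose m) (R m))"
      unfolding eqS using funpow_fdiff_add[OF T b, of "Suc m"] by blast
    then have "(fdiff ^^ Suc m) (binomial_sum (Suc m) d') = fdiff ((fdiff ^^ m) ?T) + w'"
      unfolding fdiff_binomial by simp
    moreover have "fdiff ((fdiff ^^ m) ?T) + w' \<in> poly (i + Suc m + \<delta>)"
      using poly_add[OF poly_fdiff[OF DT], of w'] w' by simp
    ultimately have 3: "(fdiff ^^ Suc m) (binomial_sum (Suc m) d') \<in> poly (i + Suc m + \<delta>)" by simp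
    have 4: "binomial_sum (Suc m) d' \<in> poly i" unfolding eqS by (intro poly_add T b)
    have 5: "\<forall>k<Suc m. d' k \<in> F (i + k) \<and> d' k - (fdiff ^^ k) g 0 \<in> F (i + k + \<delta>)"
      using d RmF 1 by (auto simp: d'_def less_Suc_eq)
    show ?case by (rule exI[of _ d'], intro conjI 5 4 3) (use 2 in blast)
  qed
  from this[of M] obtain d where
    d': "\<forall>k<M. d k \<in> F (i + k) \<and> d k - (fdiff ^^ k) g 0 \<in> F (i + k + \<delta>)"
    and d: "\<forall>n<M. g n = binomial_sum M d n" and T: "binomial_sum M d \<in> poly i"
    by (elim exE conjE)
  have R: "- binomial_sum M d + g \<in> poly i" by (intro poly_add poly_uminus T g)
  have "(fdiff ^^ M) (- binomial_sum M d + g) = 0"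
    using poly_value[OF poly_funpow[OF R, of M]] M by auto
  then have "- binomial_sum M d + g = 0"
    by (rule fdiff_eq_0) (use d in simp)
  then have "g = binomial_sum M d" by (metis add.left_inverse add_left_imp_eq)
  then have "g n = binomial_sum M d n" for n by (rule fun_cong)
  with d' show ?thesis by (intro that[of d]) simp_all
qed

text \<open>A form of the Hall--Petrescu formula. The sequence S n = n(z + x) - n x satisfies
  S (n + 1) = S n + s n, where s n is the conjugate of z by n x, and the differences of s are
  iterated commutators with x.\<close>
lemma power_expansion:
  assumes x: "\<And>k f. 0 < k \<Longrightarrow> f \<in> F k \<Longrightarrow> commutator x f \<in> F (Suc k)"
    and z: "z \<in> F 1" and M: "F M = {0}"
  obtains d where "d 0 = 0" "d 1 = z" "\<And>k. k < M \<Longrightarrow> d k \<in> F k"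
    "\<And>k. Suc k < M \<Longrightarrow> d (Suc k) - (commutator x ^^ k) z \<in> F (Suc k + \<delta>)"
    "\<And>n. mul n (z + x) = binomial_sum M d n + mul n x"
proof -
  define s where "s = (\<lambda>n. mul n x + z - mul n x)"
  define S where "S = (\<lambda>n. mul n (z + x) - mul n x)"
  have s_Suc: "s (Suc n) = x + s n - x" for n
    by (simp add: s_def group_simps)
  have Ds: "(fdiff ^^ k) s = (\<lambda>n. (commutator x ^^ k) (s n))" for k
  proof (induction k)
    case (Suc k)
    have conj: "(commutator x ^^ k) (x + f - x) = x + (commutator x ^^ k) f - x" for f
      by (induction k) (auto simp: commutator_def group_simps)
    show ?case using Suc s_Suc by (simp add: fdiff_def fun_eq_iff conj) (simp add: commutator_def)
  qed simp
  have sF: "s n \<in> F 1" for n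
  proof (induction n)
    case (Suc n)
    have "commutator x (s n) \<in> F 1" using x[OF _ Suc] F_Suc by auto
    then show ?case unfolding s_Suc conj_eq_commutator using subgrp_add[OF F_sub] Suc by blast
  qed (use z in \<open>simp add: s_def\<close>)
  have DsF: "(fdiff ^^ k) s n \<in> F (Suc k)" for k n
    unfolding Ds using sF by (induction k) (auto intro: x)
  have S_Suc: "S (Suc n) = S n + s n" for n
    unfolding S_def s_def mul_Suc2[of n "z + x"] mul.simps(2)[of n x]
    by (simp add: group_simps flip: mul_uminus)
      (metis add.assoc add.right_neutral add_minus_cancel commutes_mul minus_add_cancel mul_uminus)
  have DS: "fdiff S = commutator S s + s"
    by (rule ext) (simp add: fdiff_def S_Suc commutator_def fun_diff_def group_simps)
  have SF: "S n \<in> F 0" for n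
    by (induction n) (use S_Suc sF F_Suc[of 0] in \<open>auto simp: S_def intro!: subgrpD[OF F_sub]\<close>)
  \<comment> \<open>By \<open>DS\<close> the difference of \<open>S\<close> is built from
    \<open>S\<close> and \<open>s\<close>, and the differences of \<open>s\<close> are generators
    themselves. So this family meets the hypotheses of \<open>closure_imp_poly\<close>, with
    \<open>S\<close> at index 0 and \<open>s\<close> at index 1.\<close>
  define B where "B i = (if i = 0 then {S} else {(fdiff ^^ (i - 1)) s})" for i
  have Bs: "closure B (Suc k) ((fdiff ^^ k) s)" for k
    by (rule closure.base) (simp add: B_def)
  have BS: "closure B 0 S" by (rule closure.base) (simp add: B_def)
  have B1: "g n \<in> F i" if "g \<in> B i" for i g n
    using that SF DsF[of "i - 1" n] by (auto simp: B_def split: if_splits)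
  have B2: "closure B (Suc i) (fdiff g)" if "g \<in> B i" for i g
  proof (cases i)
    case 0
    have "closure B (Suc 0) (commutator S s + s)"
      using Bs[of 0] by (intro closure.add closure_comm_le[OF BS Bs[of 0, simplified]]) auto
    then show ?thesis using that 0 by (simp add: B_def DS)
  next
    case (Suc j)
    then show ?thesis using that Bs[of "Suc j"] by (simp add: B_def)
  qed
  have poly: "g \<in> poly i" if "closure B i g" for i g
    by (rule closure_imp_poly[OF _ _ that]) (rule B1 B2, assumption)+
  have S: "S \<in> poly 0" by (rule poly[OF BS])
  have s: "s \<in> poly 1" using poly[OF Bs[of 0]] by simp
  have c: "commutator S s \<in> poly (1 + \<delta>)" using poly_comm[OF S s] by simp
  obtain d where d: "\<And>k. k < M \<Longrightarrow> d k \<in> F k"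
    "\<And>k. k < M \<Longrightarrow> d k - (fdiff ^^ k) S 0 \<in> F (k + \<delta>)"
    "\<And>n. S n = binomial_sum M d n" using taylor[OF S, of M] M by auto
  have d2: "d (Suc k) - (commutator x ^^ k) z \<in> F (Suc k + \<delta>)" if "Suc k < M" for k
  proof -
    obtain w where w: "w \<in> poly (1 + k + \<delta>)"
      and eq: "(fdiff ^^ k) (commutator S s + s) = (fdiff ^^ k) (commutator S s) + w + (fdiff ^^ k) s"
      using funpow_fdiff_add[OF poly_antimono[OF _ c] s] by auto
    have "(fdiff ^^ Suc k) S = (fdiff ^^ k) (commutator S s + s)"
      unfolding DS[symmetric] by (simp add: funpow_swap1)
    then have "(fdiff ^^ Suc k) S 0 - (commutator x ^^ k) z = (fdiff ^^ k) (commutator S s) 0 + w 0"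
      unfolding eq by (simp add: Ds) (simp add: s_def)
    moreover have "(fdiff ^^ k) (commutator S s) 0 \<in> F (Suc k + \<delta>)"
      using poly_value[OF poly_funpow[OF c, of k]] by (simp add: add.commute add.left_commute)
    moreover have "w 0 \<in> F (Suc k + \<delta>)" using poly_value[OF w] by simp
    ultimately have "(fdiff ^^ Suc k) S 0 - (commutator x ^^ k) z \<in> F (Suc k + \<delta>)"
      using subgrp_add[OF F_sub] by metis
    from subgrp_add[OF F_sub d(2)[OF that] this] show ?thesis by (simp add: group_simps)
  qed
  \<comment> \<open>For \<open>M \<le> 1\<close> the expansion says nothing about the coefficients
    at 0 or 1; resetting them makes \<open>d 0 = 0\<close> and \<open>d 1 = z\<close>
    unconditional.\<close>
  define d' where "d' = (\<lambda>k. if k = 0 then 0 else if k = 1 then z else d k)"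
  have d0: "d 0 = 0" if "0 < M"
  proof -
    have "[0..<M] = 0 # [1..<M]" using that by (simp add: upt_conv_Cons)
    then have "S 0 = d 0 + (\<Sum>k\<leftarrow>[1..<M]. mul (0 choose k) (d k))"
      unfolding d(3) by simp
    also have "(\<Sum>k\<leftarrow>[1..<M]. mul (0 choose k) (d k)) = 0"
      by (rule sum_list_eq_0) (simp add: binomial_eq_0)
    finally show ?thesis by (simp add: S_def)
  qed
  have d1: "d 1 = z" if "1 < M"
  proof -
    have "[0..<M] = 0 # 1 # [2..<M]" using that by (simp add: upt_conv_Cons numeral_2_eq_2)
    then have "S 1 = d 0 + (d 1 + (\<Sum>k\<leftarrow>[2..<M]. mul (1 choose k) (d k)))"
      unfolding d(3) by simp
    also have "(\<Sum>k\<leftarrow>[2..<M]. mul (1 choose k) (d k)) = 0"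
      by (rule sum_list_eq_0) (simp add: binomial_eq_0)
    finally show ?thesis using d0 that by (simp add: S_def)
  qed
  have eq: "d' k = d k" if "k < M" for k
    using that d0 d1 by (auto simp: d'_def)
  show ?thesis
  proof (rule that[of d'])
    show "d' 0 = 0" "d' 1 = z" by (auto simp: d'_def)
    show "d' k \<in> F k" if "k < M" for k using d(1)[OF that] eq[OF that] by simp
    show "d' (Suc k) - (commutator x ^^ k) z \<in> F (Suc k + \<delta>)" if "Suc k < M" for k
      using d2[OF that] eq[OF that] by simp
    show "mul n (z + x) = binomial_sum M d' n + mul n x" for n
    proof -
      have "binomial_sum M d' n = binomial_sum M d n"
        by (intro arg_cong[of _ _ sum_list] map_cong) (auto simp: eq)
      then show ?thesis unfolding d(3)[symmetric] S_def by simp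
    qed
  qed
qed

end

section \<open>The lower central series\<close>

text \<open>gam H n is the usual n-th term; the extra term gam H 0 = H makes the commutator inclusion
  hold for all indices.\<close>
fun gam :: "'g::group_add set \<Rightarrow> nat \<Rightarrow> 'g set" where
  "gam H 0 = H"
| "gam H (Suc 0) = H"
| "gam H (Suc (Suc n)) = gen_by {commutator u y | u y. u \<in> gam H (Suc n) \<and> y \<in> H}"

lemma subgrp_gam: "subgrp H \<Longrightarrow> subgrp (gam H n)"
  by (induction H n rule: gam.induct) (auto intro: subgrp_gen_by)

lemma commutator_gam_right:
  assumes "u \<in> gam H i" "y \<in> H" "0 < i" shows "commutator u y \<in> gam H (Suc i)"
  using assms by (cases i) (auto intro!: gen_base)

lemma gam_normal_aux:
  assumes H: "subgrp H"
  shows "gam H (Suc n) \<subseteq> H \<and> gam H (Suc (Suc n)) \<subseteq> gam H (Suc n)"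
proof (induction n)
  case 0
  have "gam H (Suc (Suc 0)) \<subseteq> H"
    unfolding gam.simps by (rule gen_by_least[OF H]) (use subgrp_commutator[OF H] in blast)
  then show ?case by simp
next
  case (Suc n)
  have "gam H (Suc (Suc (Suc n))) \<subseteq> gam H (Suc (Suc n))"
    unfolding gam.simps(3)[of H "Suc n"]
  proof (rule gen_by_least[OF subgrp_gam[OF H]], safe)
    fix u y assume "u \<in> gam H (Suc (Suc n))" "y \<in> H"
    then show "commutator u y \<in> gam H (Suc (Suc n))"
      using Suc commutator_gam_right[of u H "Suc n" y] by auto
  qed
  then show ?case using Suc by auto
qed

declare gam.simps(3) [simp del]

lemma gam_Suc_subset: "subgrp H \<Longrightarrow> gam H (Suc n) \<subseteq> gam H n"
  using gam_normal_aux[of H] by (cases n) auto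

lemma gam_antimono: "subgrp H \<Longrightarrow> i \<le> j \<Longrightarrow> gam H j \<subseteq> gam H i"
  using lift_Suc_antimono_le[of "gam H"] gam_Suc_subset[of H] by blast

lemma gam_subset: "subgrp H \<Longrightarrow> gam H n \<subseteq> H"
  using gam_antimono[of H 0 n] by simp

lemma gam_conj:
  assumes H: "subgrp H" and u: "u \<in> gam H i" and y: "y \<in> H"
  shows "y + u - y \<in> gam H i"
proof (cases "i = 0")
  case True
  then show ?thesis using u y by (auto intro: subgrpD[OF H])
next
  case False
  then have "commutator y u \<in> gam H i"
    using commutator_gam_right[OF u y] gam_Suc_subset[OF H, of i] subgrp_uminus[OF subgrp_gam[OF H]]
    by (metis bot_nat_0.not_eq_extremum subsetD uminus_commutator)
  then show ?thesis unfolding conj_eq_commutator using u subgrp_add[OF subgrp_gam[OF H]] by blast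
qed

text \<open>The three subgroups lemma: Hall--Witt expresses [[u,y],v] through [u,[y,v]] and [y,[v,u]].\<close>
lemma commutator_gam_Suc:
  assumes H: "subgrp H"
  shows "u \<in> gam H (Suc i) \<Longrightarrow> v \<in> gam H (Suc j) \<Longrightarrow> commutator u v \<in> gam H (Suc i + Suc j)"
proof (induction i arbitrary: u v j)
  case 0
  then have "commutator v u \<in> gam H (Suc (Suc j))" 
    using commutator_gam_right[of v H "Suc j" u] by simp
  from subgrp_uminus[OF subgrp_gam[OF H] this] show ?case by (simp add: uminus_commutator)
next
  case (Suc i)
  let ?K = "gam H (Suc (Suc i) + Suc j)"
  have K: "subgrp ?K" by (rule subgrp_gam[OF H])
  let ?W = "{w \<in> H. \<forall>v\<in>gam H (Suc j). commutator w v \<in> ?K}"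
  have W: "subgrp ?W"
    unfolding subgrp_def
  proof (intro conjI ballI)
    show "0 \<in> ?W" using subgrp_zero[OF H] subgrp_zero[OF K] by simp
    show "a + b \<in> ?W" if "a \<in> ?W" "b \<in> ?W" for a b
      using that unfolding commutator_add_left mem_Collect_eq
      by (auto intro: subgrp_add[OF H] subgrp_add[OF subgrp_gam[OF H]] gam_conj[OF H])
    show "- a \<in> ?W" if "a \<in> ?W" for a
    proof -
      have "commutator (- a) v \<in> ?K" if v: "v \<in> gam H (Suc j)" for v
      proof -
        have "commutator (- a) v = - a + (- commutator a v) - (- a)"
          by (simp add: commutator_def group_simps)
        moreover have "commutator a v \<in> ?K" and "a \<in> H" using \<open>a \<in> ?W\<close> v by blast+
        ultimately show ?thesis
          using gam_conj[OF H subgrp_uminus[OF K] subgrp_uminus[OF H]] by metis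
      qed
      then show ?thesis using that subgrp_uminus[OF H] by blast
    qed
  qed
  have "commutator (commutator a y) v \<in> ?K" if a: "a \<in> gam H (Suc i)" and y: "y \<in> H"
    and v: "v \<in> gam H (Suc j)" for a y v
  proof -
    define z where "z = - y + v - (- y)"
    have vz: "v = y + z - y" by (simp add: z_def group_simps)
    have z: "z \<in> gam H (Suc j)" unfolding z_def
      by (rule gam_conj[OF H v subgrp_uminus[OF H y]])
    have zH: "z \<in> H" and aH: "a \<in> H" using z a gam_subset[OF H] by blast+
    have "commutator z y \<in> gam H (Suc (Suc j))" by (rule commutator_gam_right[OF z y]) simp
    then have yz: "commutator y z \<in> gam H (Suc (Suc j))"
      using subgrp_uminus[OF subgrp_gam[OF H]] uminus_commutator[of z y] by metis
    have "z + a - z \<in> gam H (Suc i)" by (rule gam_conj[OF H a zH])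
    from Suc.IH[OF this yz] have "commutator (z + a - z) (commutator y z) \<in> ?K" by simp
    then have 1: "commutator (commutator y z) (z + a - z) \<in> ?K"
      using subgrp_uminus[OF K] uminus_commutator by metis
    have "commutator z a \<in> gam H (Suc i + Suc j)"
      using Suc.IH[OF a z] subgrp_uminus[OF subgrp_gam[OF H]] uminus_commutator by metis
    then have 2: "commutator (commutator z a) (a + y - a) \<in> ?K"
      using commutator_gam_right[of "commutator z a" H "Suc i + Suc j" "a + y - a"]
      by (auto intro: subgrpD[OF H] aH y)
    from hall_witt[of a y z]
    have "commutator (commutator a y) v = - (commutator (commutator y z) (z + a - z)
      + commutator (commutator z a) (a + y - a))"
      unfolding vz[symmetric] by (simp add: eq_neg_iff_add_eq_0 add.assoc)
    then show ?thesis using subgrp_uminus[OF K subgrp_add[OF K 1 2]] by simp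
  qed
  then have "gam H (Suc (Suc i)) \<subseteq> ?W"
    unfolding gam.simps
    by (intro gen_by_least[OF W]) (use subgrp_commutator[OF H] gam_subset[OF H] in blast)
  then show ?case using Suc.prems by blast
qed

lemma commutator_gam:
  assumes H: "subgrp H" and "u \<in> gam H i" "v \<in> gam H j"
  shows "commutator u v \<in> gam H (i + j)"
proof (cases "i = 0 \<or> j = 0")
  case False
  then obtain i' j' where "i = Suc i'" "j = Suc j'" by (metis not0_implies_Suc)
  then show ?thesis using commutator_gam_Suc[OF H] assms by blast
next
  case True
  have "commutator a b \<in> gam H k" if "a \<in> gam H k" "b \<in> H" for a b k
  proof -
    have "commutator a b = a + (b + (- a) - b)" by (simp add: commutator_def group_simps)
    then show ?thesis using that
      by (auto intro!: subgrp_add[OF subgrp_gam[OF H]] gam_conj[OF H] subgrp_uminus[OF subgrp_gam[OF H]])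
  qed
  moreover from this have "commutator b a \<in> gam H k" if "a \<in> gam H k" "b \<in> H" for a b k
    using subgrp_uminus[OF subgrp_gam[OF H]] uminus_commutator that by metis
  ultimately show ?thesis using True assms by auto
qed

lemma commutator_gam_le:
  "subgrp H \<Longrightarrow> u \<in> gam H i \<Longrightarrow> v \<in> gam H j \<Longrightarrow> k \<le> i + j \<Longrightarrow> commutator u v \<in> gam H k"
  using commutator_gam gam_antimono by blast

text \<open>Encodes a homomorphism with abelian image on the quotient of two consecutive terms.\<close>
definition lin :: "'g::group_add set \<Rightarrow> nat \<Rightarrow> ('g \<Rightarrow> 'g) \<Rightarrow> bool" where
  "lin H k T \<longleftrightarrow> (\<forall>u\<in>gam H k. \<forall>v\<in>gam H k. T (u + v) = T u + T v \<and> T u + T v = T v + T u) \<and>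
     (\<forall>u\<in>gam H (Suc k). T u = 0)"

lemma linD:
  assumes "lin H k T"
  shows lin_add: "u \<in> gam H k \<Longrightarrow> v \<in> gam H k \<Longrightarrow> T (u + v) = T u + T v"
    and lin_commute: "u \<in> gam H k \<Longrightarrow> v \<in> gam H k \<Longrightarrow> T u + T v = T v + T u"
    and lin_0: "u \<in> gam H (Suc k) \<Longrightarrow> T u = 0"
  using assms unfolding lin_def by blast+

context
  fixes H :: "'g::group_add set"
  assumes H: "subgrp H"
begin

lemma lin_zero: "lin H k T \<Longrightarrow> T 0 = 0"
  using lin_0 subgrp_zero[OF subgrp_gam[OF H]] by blast

lemma lin_uminus:
  assumes "lin H k T" "u \<in> gam H k" shows "T (- u) = - T u"
proof -
  have "T u + T (- u) = 0"
    using lin_add[OF assms(1,2) subgrp_uminus[OF subgrp_gam[OF H] assms(2)]] lin_zero[OF assms(1)] by simp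
  then show ?thesis by (simp add: minus_unique)
qed

lemma lin_cong:
  assumes "lin H k T" "u \<in> gam H k" "v \<in> gam H k" "u - v \<in> gam H (Suc k)"
  shows "T u = T v"
proof -
  have "T u = T (u - v) + T v"
    using lin_add[OF assms(1) _ assms(3), of "u - v"] subgrp_diff[OF subgrp_gam[OF H] assms(2,3)] by simp
  then show ?thesis using lin_0[OF assms(1,4)] by simp
qed

lemma lin_conj:
  assumes T: "lin H k T" and u: "u \<in> gam H k" and y: "y \<in> H"
  shows "T (y + u - y) = T u"
  by (rule lin_cong[OF T gam_conj[OF H u y] u])
    (use commutator_gam[OF H, of y 1 u k] u y in \<open>simp add: commutator_def\<close>)

lemma lin_commutator_right:
  assumes T: "lin H k T" and y: "y \<in> gam H j" and k: "k = i + j"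
  shows "lin H i (\<lambda>u. T (commutator y u))"
proof -
  have yu: "commutator y u \<in> gam H k" if "u \<in> gam H i" for u
    using commutator_gam[OF H y that] by (simp add: k add.commute)
  have "T (commutator y (u + v)) = T (commutator y u) + T (commutator y v)"
    if u: "u \<in> gam H i" and v: "v \<in> gam H i" for u v
  proof -
    have uH: "u \<in> H" using u gam_subset[OF H] by blast
    have "T (commutator y (u + v)) = T (commutator y u) + T (u + commutator y v - u)"
      unfolding commutator_add_right
      by (rule lin_add[OF T yu[OF u] gam_conj[OF H yu[OF v] uH]])
    then show ?thesis using lin_conj[OF T yu[OF v] uH] by simp
  qed
  moreover have "T (commutator y u) = 0" if "u \<in> gam H (Suc i)" for u
    using commutator_gam[OF H y that] by (intro lin_0[OF T]) (simp add: k add.commute)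
  ultimately show ?thesis unfolding lin_def using yu lin_commute[OF T] by blast
qed

lemma lin_commutator_add_left:
  assumes T: "lin H (i + j) T" and x: "x \<in> gam H i" and y: "y \<in> gam H i" and u: "u \<in> gam H j"
  shows "T (commutator (x + y) u) = T (commutator x u) + T (commutator y u)"
proof -
  have xH: "x \<in> H" using x gam_subset[OF H] by blast
  have xu: "commutator x u \<in> gam H (i + j)" and yu: "commutator y u \<in> gam H (i + j)"
    using commutator_gam[OF H] x y u by auto
  have "T (commutator (x + y) u) = T (x + commutator y u - x) + T (commutator x u)"
    unfolding commutator_add_left by (rule lin_add[OF T gam_conj[OF H yu xH] xu])
  then show ?thesis using lin_conj[OF T yu xH] lin_commute[OF T xu yu] by simp
qed

lemma lin_commutator_swap:
  assumes T: "lin H (i + j) T" and x: "x \<in> gam H i" and u: "u \<in> gam H j"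
  shows "T (commutator u x) = - T (commutator x u)"
  using lin_uminus[OF T commutator_gam[OF H x u]] by (simp add: uminus_commutator)

lemma lin_commutator_mul_left:
  assumes T: "lin H (i + j) T" and x: "x \<in> gam H i" and u: "u \<in> gam H j"
  shows "T (commutator (mul n x) u) = mul n (T (commutator x u))"
  by (induction n) (simp_all add: lin_zero[OF T] lin_commutator_add_left[OF T x _ u] subgrp_mul[OF subgrp_gam[OF H] x])

lemma lin_eq_0:
  assumes T: "lin H (Suc (Suc k)) T" and gen: "\<And>y u. y \<in> H \<Longrightarrow> u \<in> gam H (Suc k) \<Longrightarrow> T (commutator y u) = 0"
    and c: "c \<in> gam H (Suc (Suc k))"
  shows "T c = 0"
proof -
  let ?S = "{c \<in> gam H (Suc (Suc k)). T c = 0}"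
  note G = subgrp_gam[OF H, of "Suc (Suc k)"]
  have "subgrp ?S"
    unfolding subgrp_def
    by (auto simp: lin_zero[OF T] lin_add[OF T] lin_uminus[OF T] intro: subgrpD[OF G])
  moreover have "commutator u y \<in> ?S" if u: "u \<in> gam H (Suc k)" and y: "y \<in> H" for u y
    using commutator_gam_right[OF u y] lin_commutator_swap[of 1 "Suc k" T y u] T gen[OF y u] u y by simp
  ultimately have "gam H (Suc (Suc k)) \<subseteq> ?S"
    unfolding gam.simps(3)[of H k] by (intro gen_by_least) auto
  then show ?thesis using c by blast
qed

text \<open>Hall--Witt turns into the Jacobi identity: its conjugated arguments differ from the
  plain ones by deeper commutators, which \<open>T\<close> does not see.\<close>

lemma lin_jacobi:
  assumes T: "lin H (i + j + k) T"
    and x: "x \<in> gam H i" and y: "y \<in> gam H j" and z: "z \<in> gam H k"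
  shows "T (commutator (commutator x y) z) + T (commutator (commutator y z) x)
    + T (commutator (commutator z x) y) = 0"
proof -
  have xH: "x \<in> H" and yH: "y \<in> H" and zH: "z \<in> H" using x y z gam_subset[OF H] by blast+
  have *: "commutator (commutator a b) c \<in> gam H (l + m + n)"
    if "a \<in> gam H l" "b \<in> gam H m" "c \<in> gam H n" for a b c l m n
    using that by (intro commutator_gam[OF H])
  have cong: "T (commutator w (g + a - g)) = T (commutator w a)"
    if w: "w \<in> gam H l" and a: "a \<in> gam H m" and g: "g \<in> H" and eq: "i + j + k = l + m" for w a g l m
  proof -
    have ga: "commutator g a \<in> gam H (Suc m)" using commutator_gam[OF H, of g 1 a m] g a by simp
    have L: "lin H m (\<lambda>u. T (commutator w u))"
      by (rule lin_commutator_right[OF T w]) (simp add: eq)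
    show ?thesis by (rule lin_conj[OF L a g])
  qed
  have 1: "commutator (commutator x y) (y + z - y) \<in> gam H (i + j + k)"
    by (intro * x y gam_conj[OF H z yH])
  have 2: "commutator (commutator y z) (z + x - z) \<in> gam H (i + j + k)"
    using *[OF y z gam_conj[OF H x zH]] by (simp add: ac_simps)
  have 3: "commutator (commutator z x) (x + y - x) \<in> gam H (i + j + k)"
    using *[OF z x gam_conj[OF H y xH]] by (simp add: ac_simps)
  have "0 = T (commutator (commutator x y) (y + z - y) + commutator (commutator y z) (z + x - z)
     + commutator (commutator z x) (x + y - x))"
    unfolding hall_witt by (rule lin_zero[OF T, symmetric])
  also have "\<dots> = T (commutator (commutator x y) (y + z - y)) + T (commutator (commutator y z) (z + x - z))
     + T (commutator (commutator z x) (x + y - x))"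
    using lin_add[OF T subgrp_add[OF subgrp_gam[OF H] 1 2] 3] lin_add[OF T 1 2] by simp
  also have "T (commutator (commutator x y) (y + z - y)) = T (commutator (commutator x y) z)"
    by (rule cong[OF commutator_gam[OF H x y] z yH]) simp
  also have "T (commutator (commutator y z) (z + x - z)) = T (commutator (commutator y z) x)"
    by (rule cong[OF commutator_gam[OF H y z] x zH]) simp
  also have "T (commutator (commutator z x) (x + y - x)) = T (commutator (commutator z x) y)"
    by (rule cong[OF commutator_gam[OF H z x] y xH]) simp
  finally show ?thesis by simp
qed

end

section \<open>Groups of class six with central powers\<close>

lemma dvd_prime_power_choose:
  assumes "Factorial_Ring.prime (p::nat)" "\<not> p dvd k"
  shows "p ^ n dvd (p ^ n choose k)"
proof -
  have "k > 0" using assms(2) by (cases k) auto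
  then have "k * (p ^ n choose k) = p ^ n * (p ^ n - 1 choose (k - 1))"
    by (rule times_binomial_minus1_eq)
  moreover have "coprime (p ^ n) k" using assms prime_imp_coprime_nat by simp
  ultimately show ?thesis by (metis coprime_dvd_mult_right_iff dvd_triv_left)
qed

lemma mul_dvd_eq_0: "m dvd n \<Longrightarrow> mul m x = 0 \<Longrightarrow> mul n x = 0"
  by (metis dvd_def mul_mult mul_zero mult.commute)

lemma mul_coprime_eq_0:
  assumes "coprime m n" "mul m x = 0" "mul n (x::'g::group_add) = 0" shows "x = 0"
proof (cases "m = 0")
  case True
  then show ?thesis using assms by simp
next
  case False
  then obtain a b where "m * a = n * b + 1" using bezout_nat[OF False, of n] assms(1) by auto
  then have "mul (m * a) x = mul (n * b) x + x" by (simp add: mul_Suc2 del: mul.simps)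
  then show ?thesis using mul_dvd_eq_0[of m "m * a" x] mul_dvd_eq_0[of n "n * b" x] assms by simp
qed

lemma add_eq_0_commute: "a + b = 0 \<Longrightarrow> b + a = (0::'g::group_add)"
  by (metis add.left_inverse minus_unique)

lemma commutator_mul_right:
  assumes "commutator (commutator y c) c = 0"
  shows "commutator y (mul m c) = mul m (commutator y c)"
proof (induction m)
  case (Suc m)
  have "commutator y c + c = c + commutator y c" using assms by (simp add: commutator_eq_0_iff)
  then have "mul m (commutator y c) + c = c + mul m (commutator y c)" by (rule commutes_mul)
  then have "c + mul m (commutator y c) - c = mul m (commutator y c)"
    by (metis add_diff_cancel)
  then show ?case by (simp add: commutator_add_right Suc)
qed simp

lemma sum_list_two:
  assumes "\<And>k. k < m \<Longrightarrow> k \<noteq> 1 \<Longrightarrow> k \<noteq> p \<Longrightarrow> f k = (0::'g::monoid_add)" "1 < p"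
  shows "(\<Sum>k\<leftarrow>[0..<m]. f k) = (if 1 < m then f 1 else 0) + (if p < m then f p else 0)"
  using assms
proof (induction m)
  case (Suc m)
  then have IH: "(\<Sum>k\<leftarrow>[0..<m]. f k) = (if 1 < m then f 1 else 0) + (if p < m then f p else 0)" by simp
  consider "m = 1" | "m = p" | "m \<noteq> 1" "m \<noteq> p" by blast
  then show ?case
    by cases (use IH Suc.prems in \<open>auto simp: less_Suc_eq\<close>)
qed simp

text \<open>\<open>H\<close> will be the central extension of the given group: class 5 below a
  central kernel gives class at most 6, and an \<open>e\<close>-th multiple lies over the identity,
  hence in the kernel.\<close>

locale central_powers =
  fixes H :: "'g::group_add set" and p n :: nat
  assumes H: "subgrp H" and gam_7: "gam H 7 = {0}"
    and p: "Factorial_Ring.prime p" "odd p"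
    and central: "x \<in> H \<Longrightarrow> y \<in> H \<Longrightarrow> mul (p ^ n) x + y = y + mul (p ^ n) x"
begin

abbreviation "e \<equiv> p ^ n"
abbreviation "r \<equiv> p ^ n choose p"

lemma gam_eq_0: "u \<in> gam H i \<Longrightarrow> 7 \<le> i \<Longrightarrow> u = 0"
  using gam_antimono[OF H, of 7 i] gam_7 by auto

lemma gam_le: "u \<in> gam H j \<Longrightarrow> i \<le> j \<Longrightarrow> u \<in> gam H i"
  using gam_antimono[OF H] by blast

lemma gam_singleton: "7 \<le> i \<Longrightarrow> gam H i = {0}"
  using gam_eq_0[of _ i] subgrp_zero[OF subgrp_gam[OF H], of i] by auto

lemma p_ge_3: "3 \<le> p"
  using p prime_ge_2_nat[of p] by (cases "p = 2") auto

lemma p_cases: "p = 3 \<or> p = 5 \<or> 7 \<le> p"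
proof -
  have "p \<noteq> 4" "p \<noteq> 6" using p(2) by auto
  then show ?thesis using p_ge_3 by linarith
qed

lemma e_dvd_choose: "\<not> p dvd k \<Longrightarrow> e dvd (e choose k)"
  by (rule dvd_prime_power_choose[OF p(1)])

section \<open>Expansion of \<open>e\<close>-th multiples along three filtrations\<close>

lemma filtered_gam:
  assumes "\<delta> * a \<le> 1" shows "filtered (\<lambda>k. gam H (1 + k * a)) \<delta>"
proof
  show "subgrp (gam H (1 + i * a))" for i by (rule subgrp_gam[OF H])
  show "gam H (1 + Suc i * a) \<subseteq> gam H (1 + i * a)" for i by (rule gam_antimono[OF H]) simp
  show "commutator x y \<in> gam H (1 + (i + j + \<delta>) * a)"
    if "x \<in> gam H (1 + i * a)" "y \<in> gam H (1 + j * a)" for x y i j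
    by (rule commutator_gam_le[OF H that]) (use assms in \<open>simp add: algebra_simps\<close>)
qed

lemma filtered_gam_mult: "filtered (\<lambda>k. gam H (k * i)) 0"
proof
  show "subgrp (gam H (k * i))" for k by (rule subgrp_gam[OF H])
  show "gam H (Suc k * i) \<subseteq> gam H (k * i)" for k by (rule gam_antimono[OF H]) simp
  show "commutator x y \<in> gam H ((k + l + 0) * i)" if "x \<in> gam H (k * i)" "y \<in> gam H (l * i)" for x y k l
    by (rule commutator_gam_le[OF H that]) (simp add: algebra_simps)
qed

text \<open>Steps of size \<open>a\<close> use that every commutation with \<open>x\<close> gains
  weight \<open>a\<close>: the coefficients get so deep that few of them remain.\<close>

lemma expand_gam:
  assumes x: "x \<in> gam H a" and z: "z \<in> gam H (Suc a)" and M: "7 \<le> 1 + M * a"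
  obtains d where "d 0 = 0" "d 1 = z" "\<And>k. k < M \<Longrightarrow> d k \<in> gam H (1 + k * a)"
    "mul e (z + x) = (\<Sum>k\<leftarrow>[0..<M]. mul (e choose k) (d k)) + mul e x"
proof (rule filtered.power_expansion[OF filtered_gam[of 0 a], of x z M])
  show "commutator x f \<in> gam H (1 + Suc k * a)" if "f \<in> gam H (1 + k * a)" for k f
    by (rule commutator_gam_le[OF H x that]) simp
  show "z \<in> gam H (1 + 1 * a)" using z by simp
  show "gam H (1 + M * a) = {0}" by (rule gam_singleton[OF M])
qed (use that in auto)

text \<open>Steps of size 1 with surplus 1: the coefficients are shallower than for larger steps,
  but their leading parts become known as iterated commutators with \<open>x\<close>. Six terms
  suffice because \<open>gam H 7\<close> is trivial.\<close>

lemma expand_gam2: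
  assumes x: "x \<in> H" and z: "z \<in> gam H 2"
  obtains d where "d 0 = 0" "d 1 = z" "\<And>k. k < 6 \<Longrightarrow> d k \<in> gam H (Suc k)"
    "\<And>k. Suc k < 6 \<Longrightarrow> d (Suc k) - (commutator x ^^ k) z \<in> gam H (k + 3)"
    "mul e (z + x) = (\<Sum>k\<leftarrow>[0..<6]. mul (e choose k) (d k)) + mul e x"
proof (rule filtered.power_expansion[OF filtered_gam[of 1 1], of x z 6])
  show "commutator x f \<in> gam H (1 + Suc k * 1)" if "f \<in> gam H (1 + k * 1)" for k f
    by (rule commutator_gam_le[OF H _ that, of _ 1]) (use x in auto)
  show "z \<in> gam H (1 + 1 * 1)" using z by (simp add: numeral_2_eq_2)
  show "gam H (1 + 6 * 1) = {0}" by (rule gam_singleton) simp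
  fix d assume d: "d 0 = 0" "d 1 = z" "\<And>k. k < 6 \<Longrightarrow> d k \<in> gam H (1 + k * 1)"
    "\<And>k. Suc k < 6 \<Longrightarrow> d (Suc k) - (commutator x ^^ k) z \<in> gam H (1 + (Suc k + 1) * 1)"
    "\<And>n. mul n (z + x) = (\<Sum>k\<leftarrow>[0..<6]. mul (n choose k) (d k)) + mul n x"
  have "d (Suc k) - (commutator x ^^ k) z \<in> gam H (k + 3)" if "Suc k < 6" for k
    using d(4)[OF that] by (simp add: eval_nat_numeral)
  then show thesis using d by (intro that[of d]) auto
qed simp

text \<open>Serves to show that the elements of \<open>gam H i\<close> killed by \<open>e\<close>
  are closed under addition; here both summands have weight \<open>i\<close>, so the k-th
  coefficient has weight \<open>k * i\<close>.\<close>

lemma expand_gam_add: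
  assumes u: "u \<in> gam H i" and v: "v \<in> gam H i" and M: "7 \<le> M * i"
  obtains d where "d 0 = 0" "d 1 = u" "\<And>k. k < M \<Longrightarrow> d k \<in> gam H (k * i)"
    "mul e (u + v) = (\<Sum>k\<leftarrow>[0..<M]. mul (e choose k) (d k)) + mul e v"
proof (rule filtered.power_expansion[OF filtered_gam_mult[of i], of v u M])
  show "commutator v f \<in> gam H (Suc k * i)" if "f \<in> gam H (k * i)" for k f
    by (rule commutator_gam_le[OF H v that]) simp
  show "u \<in> gam H (1 * i)" using u by simp
  show "gam H (M * i) = {0}" by (rule gam_singleton[OF M])
qed (use that in auto)

section \<open>The third lower central term is killed by \<open>e\<close>\<close>

lemma conj_central:
  assumes "x \<in> H" "y \<in> H" shows "mul e (commutator y x + x) = mul e x"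
proof -
  have "mul e (y + x - y) = y + mul e x - y" by (rule mul_conj)
  also have "y + mul e x = mul e x + y" using central[OF assms] by simp
  finally show ?thesis by (simp add: conj_eq_commutator)
qed

text \<open>For \<open>i \<ge> 3\<close> the steps have size at least 2, so three terms already
  exhaust the class. The only binomial coefficient beyond \<open>e\<close> itself is then
  \<open>e choose 2\<close>, divisible by \<open>e\<close> because p is odd, and it multiplies an
  element of \<open>gam H (Suc i)\<close>. The prime 3 thus does no harm here.\<close>

lemma e_killed_step:
  assumes i: "3 \<le> i" and kill: "\<And>u. u \<in> gam H (Suc i) \<Longrightarrow> mul e u = 0"
  shows "u \<in> gam H i \<Longrightarrow> mul e u = 0"
proof -
  obtain a where a: "i = Suc a" "2 \<le> a" using i by (cases i) auto
  note G = subgrp_gam[OF H, of i]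
  have kill2: "mul (e choose k) c = 0" if "k = 2" "c \<in> gam H l" "Suc i \<le> l" for c k l
    by (rule mul_dvd_eq_0[OF e_dvd_choose kill[OF gam_le[OF that(2,3)]]])
      (use that p_ge_3 in \<open>auto dest: dvd_imp_le\<close>)
  let ?S = "{c \<in> gam H i. mul e c = 0}"
  have add: "mul e (u + v) = 0" if u: "u \<in> gam H i" "mul e u = 0" and v: "v \<in> gam H i" "mul e v = 0" for u v
  proof -
    obtain d where d: "d 0 = 0" "d 1 = u" "\<And>k. k < 3 \<Longrightarrow> d k \<in> gam H (k * i)"
      "mul e (u + v) = (\<Sum>k\<leftarrow>[0..<3]. mul (e choose k) (d k)) + mul e v"
      by (rule expand_gam_add[OF u(1) v(1), of 3]) (use i in auto)
    have "mul (e choose 2) (d 2) = 0" by (rule kill2[OF _ d(3)]) (use i in auto)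
    then show ?thesis unfolding d(4) using d(1,2) u v by (simp add: eval_nat_numeral)
  qed
  have "subgrp ?S"
    unfolding subgrp_def using add subgrpD[OF G] by (auto simp: mul_uminus)
  moreover have "commutator u y \<in> ?S" if u: "u \<in> gam H a" and y: "y \<in> H" for u y
  proof -
    have uy: "commutator u y \<in> gam H i" using commutator_gam_right[OF u y] a by simp
    then have yu: "commutator y u \<in> gam H (Suc a)"
      using subgrp_uminus[OF G] uminus_commutator a by metis
    have uH: "u \<in> H" using u gam_subset[OF H] by blast
    obtain d where d: "d 0 = 0" "d 1 = commutator y u" "\<And>k. k < 3 \<Longrightarrow> d k \<in> gam H (1 + k * a)"
      "mul e (commutator y u + u) = (\<Sum>k\<leftarrow>[0..<3]. mul (e choose k) (d k)) + mul e u"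
      by (rule expand_gam[OF u yu, of 3]) (use a in auto)
    have "mul (e choose 2) (d 2) = 0" by (rule kill2[OF _ d(3)]) (use a in auto)
    \<comment> \<open>\<open>commutator y u + u\<close> is a conjugate of \<open>u\<close> and has
      the same \<open>e\<close>-th multiple, so the expanded sum is 0; its term for k = 2 has just
      been removed.\<close>
    then have "mul e (commutator y u) = 0"
      using d(4) conj_central[OF uH y] d(1,2)
      by (simp add: eval_nat_numeral) (metis add_0 add_right_cancel)
    then have "mul e (commutator u y) = 0"
      using mul_uminus[of e "commutator y u"] by (simp add: uminus_commutator)
    then show ?thesis using uy by blast
  qed
  ultimately have "gen_by {commutator u y |u y. u \<in> gam H a \<and> y \<in> H} \<subseteq> ?S"
    by (intro gen_by_least) auto
  moreover have "gam H i = gen_by {commutator u y |u y. u \<in> gam H a \<and> y \<in> H}"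
    using a by (cases a) (auto simp: gam.simps(3))
  ultimately show "u \<in> gam H i \<Longrightarrow> mul e u = 0" by blast
qed

lemma e_killed: "3 \<le> i \<Longrightarrow> u \<in> gam H i \<Longrightarrow> mul e u = 0"
proof (induction "7 - i" arbitrary: i u)
  case 0
  then have "u = 0" using gam_eq_0[of u i] by simp
  then show ?case by simp
next
  case (Suc m)
  show ?case
  proof (rule e_killed_step[OF Suc.prems(1) _ Suc.prems(2)])
    show "mul e u = 0" if "u \<in> gam H (Suc i)" for u
      by (rule Suc.hyps(1)[OF _ _ that]) (use Suc.hyps(2) Suc.prems(1) in auto)
  qed
qed

lemma choose_killed:
  assumes "\<not> p dvd k" "3 \<le> i" "u \<in> gam H i" shows "mul (e choose k) u = 0"
  by (rule mul_dvd_eq_0[OF e_dvd_choose[OF assms(1)] e_killed[OF assms(2,3)]])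

section \<open>The Engel condition on the fourth term\<close>

lemma e_odd: "odd e" using p by simp

lemma double_eq_0:
  assumes "mul e t = 0" "t + t = (0::'g)" shows "t = 0"
proof (rule mul_coprime_eq_0)
  show "coprime 2 e" using e_odd by (simp only: coprime_left_2_iff_odd not_False_eq_True)
  show "mul 2 t = 0" using assms(2) by (simp add: numeral_2_eq_2)
qed (rule assms(1))

lemma gam_abelian:
  assumes "u \<in> gam H i" "v \<in> gam H j" "7 \<le> i + j" shows "u + v = v + u"
  using gam_eq_0[OF commutator_gam[OF H assms(1,2)] assms(3)] by (simp add: commutator_eq_0_iff)

text \<open>The bound 4 is the least \<open>k\<close> with 2k >= 7, which makes
  \<open>gam H k\<close> abelian.\<close>

lemma lin_mul_iff:
  assumes "4 \<le> k" "\<And>u. u \<in> gam H (Suc k) \<Longrightarrow> mul m u = 0"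
  shows "lin H k (mul m)"
  unfolding lin_def
proof (intro conjI ballI)
  fix u v assume u: "u \<in> gam H k" and v: "v \<in> gam H k"
  show "mul m (u + v) = mul m u + mul m v"
    by (rule mul_add_commute[OF gam_abelian[OF u v]]) (use assms in simp)
  show "mul m u + mul m v = mul m v + mul m u"
    by (rule gam_abelian[OF subgrp_mul[OF subgrp_gam[OF H] u] subgrp_mul[OF subgrp_gam[OF H] v]])
      (use assms in simp)
qed (use assms in blast)

text \<open>The Lie ring analogue: if [x,[x,z]] vanishes for z in the derived algebra, then the
  four-fold product [y,[x,[a,b]]] is alternating in each of the pairs (a,b), (x,y), (a,y), and the
  Jacobi identity makes it antisymmetric under (a,b) \<leftrightarrow> (x,y); both are possible only if it is 0.\<close>
lemma lin_engel_eq_0: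
  assumes T: "lin H 4 T" and eT: "\<And>c. c \<in> gam H 4 \<Longrightarrow> mul e (T c) = 0"
    and engel: "\<And>x z. x \<in> H \<Longrightarrow> z \<in> gam H 2 \<Longrightarrow> T (commutator x (commutator x z)) = 0"
    and c: "c \<in> gam H 4"
  shows "T c = 0"
proof -
  have g1: "x \<in> gam H 1" if "x \<in> H" for x using that by simp
  have c2: "commutator a b \<in> gam H 2" if "a \<in> H" "b \<in> H" for a b
    by (rule commutator_gam_le[OF H g1[OF that(1)] g1[OF that(2)]]) simp
  have c3: "commutator a z \<in> gam H 3" if "a \<in> H" "z \<in> gam H 2" for a z
    by (rule commutator_gam_le[OF H g1[OF that(1)] that(2)]) simp
  have c4: "commutator a z \<in> gam H 4" if "a \<in> H" "z \<in> gam H 3" for a z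
    by (rule commutator_gam_le[OF H g1[OF that(1)] that(2)]) simp
  have L3: "lin H 3 (\<lambda>u. T (commutator y u))" if "y \<in> H" for y
    by (rule lin_commutator_right[OF H T g1[OF that]]) simp
  have L2: "lin H 2 (\<lambda>u. T (commutator y (commutator x u)))" if "x \<in> H" "y \<in> H" for x y
    by (rule lin_commutator_right[OF H L3[OF that(2)] g1[OF that(1)]]) simp
  define g where "g x y z = T (commutator x (commutator y z))" for x y z
  have g_add1: "g (x + x') y z = g x y z + g x' y z"
    if "x \<in> H" "x' \<in> H" "y \<in> H" "z \<in> gam H 2" for x x' y z
    unfolding g_def using lin_commutator_add_left[OF H, of 1 3 T x x' "commutator y z"] T that c3 by simp
  have g_add2: "g x (y + y') z = g x y z + g x y' z"
    if "x \<in> H" "y \<in> H" "y' \<in> H" "z \<in> gam H 2" for x y y' z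
    unfolding g_def
    using lin_commutator_add_left[OF H, of 1 2 "\<lambda>u. T (commutator x u)" y y' z] L3 that
    by (simp add: eval_nat_numeral)
  have gv: "g x y z = T (commutator x (commutator y z)) \<and> commutator x (commutator y z) \<in> gam H 4"
    if "x \<in> H" "y \<in> H" "z \<in> gam H 2" for x y z
    using that c3 c4 by (simp add: g_def)
  have gcomm: "g x y z + g x' y' z' = g x' y' z' + g x y z"
    if "x \<in> H" "y \<in> H" "z \<in> gam H 2" "x' \<in> H" "y' \<in> H" "z' \<in> gam H 2" for x y z x' y' z'
    using lin_commute[OF T] gv that by metis
  have gdbl: "g x y z = 0" if "g x y z + g x y z = 0" "x \<in> H" "y \<in> H" "z \<in> gam H 2" for x y z
    using double_eq_0 eT gv that by metis
  have A1: "g y x z = - g x y z" if x: "x \<in> H" and y: "y \<in> H" and z: "z \<in> gam H 2" for x y z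
  proof -
    have xy: "x + y \<in> H" by (rule subgrp_add[OF H x y])
    have "0 = g (x + y) (x + y) z" using engel[OF xy z] by (simp add: g_def)
    also have "\<dots> = g x x z + g y x z + (g x y z + g y y z)"
      by (simp add: g_add1 g_add2 x y z xy)
    finally have "g y x z + g x y z = 0" using engel x y z by (simp add: g_def)
    then show ?thesis by (simp add: eq_neg_iff_add_eq_0)
  qed
  have A2: "g x y (commutator b a) = - g x y (commutator a b)"
    if "x \<in> H" "y \<in> H" "a \<in> H" "b \<in> H" for x y a b
    using lin_uminus[OF H L2[OF that(2,1)] c2[OF that(3,4)]]
    by (simp add: g_def uminus_commutator)
  have A3: "g y x (commutator a b) + g y a (commutator b x) + g y b (commutator x a) = 0"
    if a: "a \<in> H" and b: "b \<in> H" and x: "x \<in> H" and y: "y \<in> H" for a b x y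
  proof -
    have sw: "T (commutator y (commutator (commutator b c) a)) = g y a (commutator c b)"
      if "a \<in> H" "b \<in> H" "c \<in> H" for a b c
      using lin_commutator_swap[OF H, of 1 2 "\<lambda>u. T (commutator y u)" a "commutator b c"] L3[OF y]
        A2[OF y that] c2 that by (simp add: g_def numeral_3_eq_3)
    have "g y x (commutator b a) + g y a (commutator x b) + g y b (commutator a x) = 0"
      using lin_jacobi[OF H, of 1 1 1 "\<lambda>u. T (commutator y u)" a b x] L3[OF y] a b x sw by (simp add: eval_nat_numeral)
    then have "- (g y b (commutator x a) + (g y a (commutator b x) + g y x (commutator a b))) = 0"
      unfolding A2[OF y x a b] A2[OF y a b x] A2[OF y b x a] by (simp only: minus_add)
    then have "g y b (commutator x a) + (g y a (commutator b x) + g y x (commutator a b)) = 0"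
      by (simp only: neg_equal_0_iff_equal)
    then have "g y a (commutator b x) + g y x (commutator a b) + g y b (commutator x a) = 0"
      by (rule add_eq_0_commute)
    then show ?thesis using gcomm[OF y a c2[OF b x] y x c2[OF a b]] by simp
  qed
  \<comment> \<open>Jacobi gives \<open>g x y z - g y x z\<close>, and \<open>A1\<close> turns the
    second term into another \<open>g x y z\<close>.\<close>
  have A4': "T (commutator (commutator x y) z) = g x y z + g x y z"
    if x: "x \<in> H" and y: "y \<in> H" and z: "z \<in> gam H 2" for x y z
  proof -
    have 1: "T (commutator (commutator y z) x) = - g x y z"
      using lin_commutator_swap[OF H, of 1 3 T x "commutator y z"] T x c3[OF y z] by (simp add: g_def)
    have "T (commutator (commutator z x) y) = - T (commutator y (commutator z x))"
      using lin_commutator_swap[OF H, of 1 3 T y "commutator z x"] T y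
        c3[OF x z] subgrp_uminus[OF subgrp_gam[OF H] c3[OF x z]] by (simp add: uminus_commutator)
    also have "\<dots> = g y x z"
      using lin_uminus[OF H L3[OF y] c3[OF x z]] by (simp add: g_def uminus_commutator)
    finally have 2: "T (commutator (commutator z x) y) = - g x y z" using A1[OF x y z] by simp
    have "T (commutator (commutator x y) z) + - g x y z + - g x y z = 0"
      using lin_jacobi[OF H, of 1 1 2 T x y z] T x y z 1 2
      by (simp add: eval_nat_numeral)
    then show ?thesis by (metis add.assoc add.inverse_inverse eq_neg_iff_add_eq_0 minus_add)
  qed
  have A4: "g a b (commutator x y) = - g x y (commutator a b)"
    if a: "a \<in> H" and b: "b \<in> H" and x: "x \<in> H" and y: "y \<in> H" for a b x y
  proof -
    let ?u = "g x y (commutator a b)" and ?v = "g a b (commutator x y)"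
    \<comment> \<open>\<open>A4'\<close> reads the bracket of \<open>commutator a b\<close> and
      \<open>commutator x y\<close> in both orders; the two readings differ by a sign.\<close>
    have "?v + ?v = - (?u + ?u)"
      using lin_commutator_swap[OF H, of 2 2 T "commutator x y" "commutator a b"] T
        A4'[OF a b c2[OF x y]] A4'[OF x y c2[OF a b]] c2 a b x y by simp
    moreover have uv: "?u + ?v = ?v + ?u" using gcomm a b x y c2 by blast
    ultimately have "(?u + ?v) + (?u + ?v) = 0"
      by (metis add.assoc add.right_inverse)
    moreover have "mul e (?u + ?v) = 0"
      using mul_add_commute[OF uv, of e] eT gv a b x y c2 by (metis add.right_neutral)
    ultimately have "?u + ?v = 0" using double_eq_0 by blast
    then show ?thesis by (simp add: minus_unique)
  qed
  \<comment> \<open>In \<open>A3\<close> with y = a the middle term dies by the Engel condition,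
    while \<open>A4\<close> and \<open>A1\<close> identify the last term with the first. Twice the
    claim is therefore 0.\<close>
  have A5: "g a x (commutator a b) = 0" if a: "a \<in> H" and b: "b \<in> H" and x: "x \<in> H" for a b x
  proof -
    have "g a a (commutator b x) = 0" using engel[OF a c2[OF b x]] by (simp add: g_def)
    moreover have "g a b (commutator x a) = g a x (commutator a b)"
      using A4[OF a b x a] A1[OF a x c2[OF a b]] by simp
    ultimately show ?thesis using A3[OF a b x a] gdbl a b x c2 by simp
  qed
  have A6: "g a x (commutator y b) = - g y x (commutator a b)"
    if a: "a \<in> H" and b: "b \<in> H" and x: "x \<in> H" and y: "y \<in> H" for a b x y
  proof -
    have ay: "a + y \<in> H" by (rule subgrp_add[OF H a y])
    have "g z x (commutator (a + y) b) = g z x (commutator a b) + g z x (commutator y b)" if "z \<in> H" for z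
      using lin_commutator_add_left[OF H, of 1 1 "\<lambda>u. T (commutator z (commutator x u))" a y b]
        L2[OF x that] a y b by (simp add: g_def numeral_2_eq_2)
    moreover have "0 = g (a + y) x (commutator (a + y) b)" using A5[OF ay b x] by simp
    ultimately have "g a x (commutator a b) + g a x (commutator y b)
       + (g y x (commutator a b) + g y x (commutator y b)) = 0"
      using g_add1[OF a y x c2[OF ay b]] a y by simp
    then have "g a x (commutator y b) + g y x (commutator a b) = 0"
      using A5 a b x y by simp
    then show ?thesis by (simp add: eq_neg_iff_add_eq_0)
  qed
  \<comment> \<open>Two routes from \<open>g y x (commutator a b)\<close> to
    \<open>g b a (commutator x y)\<close>: by way of \<open>A6\<close> the sign is plus, by way of
    \<open>A4\<close> it is minus.\<close>
  have zero: "g y x (commutator a b) = 0"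
    if a: "a \<in> H" and b: "b \<in> H" and x: "x \<in> H" and y: "y \<in> H" for a b x y
  proof -
    have "g y x (commutator a b) = - g a x (commutator y b)" using A6[OF a b x y] by simp
    also have "\<dots> = g x a (commutator y b)" using A1[OF a x c2[OF y b]] by simp
    also have "\<dots> = - g x a (commutator b y)" using A2[OF x a b y] by simp
    also have "\<dots> = g b a (commutator x y)" using A6[OF x y a b] by (metis add.inverse_inverse)
    finally have 1: "g y x (commutator a b) = g b a (commutator x y)" .
    have "g b a (commutator x y) = - g a b (commutator x y)"
      using A1[OF a b c2[OF x y]] .
    also have "\<dots> = g x y (commutator a b)" using A4[OF a b x y] by simp
    also have "\<dots> = - g y x (commutator a b)" using A1[OF y x c2[OF a b]] .
    finally have "g y x (commutator a b) + g y x (commutator a b) = 0" using 1 by (metis add.right_inverse)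
    then show ?thesis using gdbl a b x y c2 by blast
  qed
  have z2: "T (commutator y (commutator x z)) = 0" if x: "x \<in> H" and y: "y \<in> H" and z: "z \<in> gam H 2" for x y z
  proof -
    have "lin H (Suc (Suc 0)) (\<lambda>u. T (commutator y (commutator x u)))"
      using L2[OF x y] by (simp add: numeral_2_eq_2)
    from lin_eq_0[OF H this, of z] show ?thesis using zero x y z by (simp add: g_def numeral_2_eq_2)
  qed
  have z3: "T (commutator y z) = 0" if y: "y \<in> H" and z: "z \<in> gam H 3" for y z
  proof -
    have "lin H (Suc (Suc 1)) (\<lambda>u. T (commutator y u))"
      using L3[OF y] by (simp add: numeral_3_eq_3)
    from lin_eq_0[OF H this, of z] show ?thesis using z2 y z by (simp add: numeral_3_eq_3 numeral_2_eq_2)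
  qed
  have "lin H (Suc (Suc 2)) T" using T by (simp add: eval_nat_numeral)
  from lin_eq_0[OF H this, of c] show ?thesis using z3 c by (simp add: eval_nat_numeral)
qed

section \<open>The case \<open>p = 3\<close>: multiplication by \<open>r\<close> kills the fifth
  term\<close>

lemma commutator_mul_right_gam:
  assumes "y \<in> gam H i" "c \<in> gam H k" "7 \<le> i + 2 * k"
  shows "commutator y (mul m c) = mul m (commutator y c)"
  by (rule commutator_mul_right, rule gam_eq_0[OF commutator_gam[OF H commutator_gam[OF H assms(1,2)] assms(2)]])
    (use assms(3) in simp)

lemma central_choose:
  assumes "\<not> p dvd k" "x \<in> H" "y \<in> H"
  shows "mul (e choose k) x + y = y + mul (e choose k) x"
proof -
  obtain m where "e choose k = e * m" using e_dvd_choose[OF assms(1)] by auto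
  then show ?thesis using central[OF subgrp_mul[OF H assms(2), of m] assms(3)] by (simp add: mul_mult)
qed

text \<open>The multiples \<open>mul e (z + x)\<close> and \<open>mul e x\<close> are central, and
  so is every term whose k is prime to 3. This leaves \<open>r\<close> times the third coefficient.
  The coefficient cannot yet be replaced by its leading part [x,[x,z]], since \<open>r\<close> may
  still be nonzero on \<open>gam H 5\<close>.\<close>

lemma r_cube_central:
  assumes p3: "p = 3" and x: "x \<in> H" and z: "z \<in> gam H 2"
  obtains d where "d \<in> gam H 4" "d - commutator x (commutator x z) \<in> gam H 5"
    "\<And>t. t \<in> H \<Longrightarrow> mul r d + t = t + mul r d"
proof -
  obtain d where d: "d 0 = 0" "d 1 = z" "\<And>k. k < 6 \<Longrightarrow> d k \<in> gam H (Suc k)"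
    "\<And>k. Suc k < 6 \<Longrightarrow> d (Suc k) - (commutator x ^^ k) z \<in> gam H (k + 3)"
    "mul e (z + x) = (\<Sum>k\<leftarrow>[0..<6]. mul (e choose k) (d k)) + mul e x"
    by (rule expand_gam2[OF x z]) blast
  let ?f = "\<lambda>k. mul (e choose k) (d k)"
  define Z where "Z = {c. \<forall>t\<in>H. c + t = t + c}"
  have Z: "subgrp Z"
    unfolding subgrp_def
  proof (intro conjI ballI)
    show "a + b \<in> Z" if "a \<in> Z" "b \<in> Z" for a b
      using that unfolding Z_def by (auto simp: add.assoc) (metis add.assoc)
    show "- a \<in> Z" if "a \<in> Z" for a
    proof -
      have "- a + t = t + - a" if "a + t = t + a" for t
      proof -
        have "- a + t = - a + (t + a) + - a" by (simp add: add.assoc)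
        also have "\<dots> = t + - a" unfolding that[symmetric] by (simp add: add.assoc)
        finally show ?thesis .
      qed
      then show ?thesis using that unfolding Z_def by blast
    qed
  qed (simp add: Z_def)
  have dH: "d k \<in> H" if "k < 6" for k using d(3)[OF that] gam_subset[OF H] by blast
  have f: "?f k \<in> Z" if "k < 6" "\<not> p dvd k" for k
    unfolding Z_def using central_choose[OF that(2) dH[OF that(1)]] by blast
  have zx: "z + x \<in> H" using subgrp_add[OF H _ x] z gam_subset[OF H] by blast
  have "mul e (z + x) - mul e x \<in> Z"
    using central[OF zx] central[OF x] by (intro subgrp_diff[OF Z]) (auto simp: Z_def)
  moreover have "mul e (z + x) - mul e x = ?f 1 + ?f 2 + ?f 3 + ?f 4 + ?f 5"
    unfolding d(5) using d(1) by (simp add: upt_rec eval_nat_numeral group_simps)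
  ultimately have sum: "?f 1 + ?f 2 + ?f 3 + ?f 4 + ?f 5 \<in> Z" by simp
  have "?f 3 = - (?f 1 + ?f 2) + (?f 1 + ?f 2 + ?f 3 + ?f 4 + ?f 5) - (?f 4 + ?f 5)"
    by (simp add: group_simps)
  also have "\<dots> \<in> Z"
    by (intro subgrp_diff[OF Z] subgrp_add[OF Z] subgrp_uminus[OF Z] sum f) (use p3 in auto)
  finally have "?f 3 \<in> Z" .
  then show ?thesis using d(3)[of 3] d(4)[of 2] that[of "d 3"] p3
    by (simp add: Z_def eval_nat_numeral)
qed

text \<open>A linear \<open>T\<close> does not distinguish the coefficient d of
  \<open>r_cube_central\<close> from [x,[x,z]]. If \<open>T\<close> also vanishes wherever the
  \<open>r\<close>-multiple is central, it satisfies the Engel condition.\<close>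

lemma r_killed_step:
  assumes p3: "p = 3" and T: "lin H 4 T"
    and T_eq: "\<And>c. c \<in> gam H 4 \<Longrightarrow> (\<And>t. t \<in> H \<Longrightarrow> mul r c + t = t + mul r c) \<Longrightarrow> T c = 0"
    and eT: "\<And>c. c \<in> gam H 4 \<Longrightarrow> mul e (T c) = 0"
    and c: "c \<in> gam H 4"
  shows "T c = 0"
proof (rule lin_engel_eq_0[OF T eT _ c])
  fix x z assume x: "x \<in> H" and z: "z \<in> gam H 2"
  obtain d where d: "d \<in> gam H 4" "d - commutator x (commutator x z) \<in> gam H 5"
    "\<And>t. t \<in> H \<Longrightarrow> mul r d + t = t + mul r d"
    using r_cube_central[OF p3 x z] by blast
  have x1: "x \<in> gam H 1" using x by simp
  have 4: "commutator x (commutator x z) \<in> gam H 4"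
    using commutator_gam[OF H x1 commutator_gam[OF H x1 z]] by (simp add: eval_nat_numeral)
  have "T d = T (commutator x (commutator x z))"
    by (rule lin_cong[OF H T d(1) 4]) (use d(2) in simp)
  then show "T (commutator x (commutator x z)) = 0" using T_eq[OF d(1,3)] by simp
qed

lemma r_e_killed: "3 \<le> i \<Longrightarrow> c \<in> gam H i \<Longrightarrow> mul e (mul m c) = 0"
  using e_killed[of i "mul m c"] subgrp_mul[OF subgrp_gam[OF H]] by blast

text \<open>On \<open>gam H 4\<close> the map \<open>r\<close> [s,[t,c]] equals
  [s,[t, \<open>r\<close> c]], so it vanishes when \<open>r\<close> c is central. The last term
  comes first: only afterwards is \<open>mul r\<close> linear on \<open>gam H 5\<close>, and the
  argument can be repeated with a single outer commutator.\<close>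

lemma r_killed_6:
  assumes p3: "p = 3" and c: "c \<in> gam H 6" shows "mul r c = 0"
proof -
  have g1: "x \<in> gam H 1" if "x \<in> H" for x using that by simp
  have L6: "lin H 6 (mul r)"
    by (rule lin_mul_iff) (auto dest!: gam_eq_0)
  have L5: "lin H 5 (\<lambda>u. mul r (commutator s u))" if s: "s \<in> H" for s
    by (rule lin_commutator_right[OF H L6 g1[OF s]]) simp
  have L4: "lin H 4 (\<lambda>u. mul r (commutator s (commutator t u)))" if s: "s \<in> H" and t: "t \<in> H" for s t
    by (rule lin_commutator_right[OF H L5[OF s] g1[OF t]]) simp
  have 4: "mul r (commutator s (commutator t u)) = 0" if s: "s \<in> H" and t: "t \<in> H" and u: "u \<in> gam H 4" for s t u
  proof (rule r_killed_step[OF p3 L4[OF s t] _ _ u])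
    fix c assume c: "c \<in> gam H 4"
    have tc: "commutator t c \<in> gam H 5" using commutator_gam[OF H g1[OF t] c] by simp
    have stc: "commutator s (commutator t c) \<in> gam H 6" using commutator_gam[OF H g1[OF s] tc] by simp
    show "mul e (mul r (commutator s (commutator t c))) = 0" by (rule r_e_killed[OF _ stc]) simp
    assume central: "\<And>t. t \<in> H \<Longrightarrow> mul r c + t = t + mul r c"
    have "mul r (commutator s (commutator t c)) = commutator s (commutator t (mul r c))"
      using commutator_mul_right_gam[OF g1[OF t] c, of r] commutator_mul_right_gam[OF g1[OF s] tc, of r] by simp
    also have "commutator t (mul r c) = 0" using central[OF t] by (simp add: commutator_eq_0_iff)
    finally show "mul r (commutator s (commutator t c)) = 0" by simp
  qed
  have 5: "mul r (commutator s u) = 0" if s: "s \<in> H" and u: "u \<in> gam H 5" for s u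
    using lin_eq_0[OF H, of 3 "\<lambda>u. mul r (commutator s u)" u] L5[OF s] 4[OF s] u by simp
  show ?thesis using lin_eq_0[OF H, of 4 "mul r" c] L6 5 c by simp
qed

lemma r_killed_5:
  assumes p3: "p = 3" and c: "c \<in> gam H 5" shows "mul r c = 0"
proof -
  have g1: "x \<in> gam H 1" if "x \<in> H" for x using that by simp
  have L5: "lin H 5 (mul r)"
    by (rule lin_mul_iff) (use r_killed_6[OF p3] in auto)
  have L4: "lin H 4 (\<lambda>u. mul r (commutator t u))" if t: "t \<in> H" for t
    by (rule lin_commutator_right[OF H L5 g1[OF t]]) simp
  have 4: "mul r (commutator t u) = 0" if t: "t \<in> H" and u: "u \<in> gam H 4" for t u
  proof (rule r_killed_step[OF p3 L4[OF t] _ _ u])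
    fix c assume c: "c \<in> gam H 4"
    have tc: "commutator t c \<in> gam H 5" using commutator_gam[OF H g1[OF t] c] by simp
    show "mul e (mul r (commutator t c)) = 0" by (rule r_e_killed[OF _ tc]) simp
    assume central: "\<And>t. t \<in> H \<Longrightarrow> mul r c + t = t + mul r c"
    then show "mul r (commutator t c) = 0"
      using commutator_mul_right_gam[OF g1[OF t] c, of r] commutator_eq_0_iff[of t "mul r c"] t by simp
  qed
  show ?thesis using lin_eq_0[OF H, of 3 "mul r" c] L5 4 c by simp
qed

text \<open>What matters is that \<open>r\<close> kills \<open>gam H (p + 2)\<close>: for p = 3 this
  is \<open>r_killed_5\<close>, for p >= 5 that term is trivial.\<close>

lemma lin_mul_r: "lin H (Suc p) (mul r)"
proof (rule lin_mul_iff)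
  show "mul r u = 0" if "u \<in> gam H (Suc (Suc p))" for u
  proof (cases "p = 3")
    case True
    then show ?thesis using r_killed_5[OF True] that by simp
  next
    case False
    then have "7 \<le> Suc (Suc p)" using p_cases by auto
    then show ?thesis using gam_eq_0[OF that] by simp
  qed
qed (use p_ge_3 in simp)

section \<open>The relation between the \<open>e\<close>-th and \<open>r\<close>-th
  multiples\<close>

lemma ad_gam:
  assumes "x \<in> H" "z \<in> gam H j" shows "(commutator x ^^ k) z \<in> gam H (k + j)"
proof (induction k)
  case (Suc k)
  then show ?case using commutator_gam[OF H, of x 1] assms(1) by simp
qed (use assms in simp)

text \<open>In the expansion for the conjugate of \<open>x\<close> the summand
  \<open>mul e x\<close> cancels. Terms with 2 <= k < 6 other than k = p lie in
  \<open>gam H 3\<close> with coefficient divisible by \<open>e\<close> and vanish; linearity of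
  \<open>mul r\<close> replaces the p-th coefficient by its leading part. For p >= 7 the
  \<open>r\<close>-term is absent from the sum and zero in the statement.\<close>

lemma commutator_relation:
  assumes x: "x \<in> H" and y: "y \<in> H"
  shows "mul e (commutator y x) + mul r ((commutator x ^^ (p - 1)) (commutator y x)) = 0"
proof -
  have z: "commutator y x \<in> gam H 2" using commutator_gam[OF H, of y 1 x 1] x y by (simp add: numeral_2_eq_2)
  obtain d where d: "d 0 = 0" "d 1 = commutator y x" "\<And>k. k < 6 \<Longrightarrow> d k \<in> gam H (Suc k)"
    "\<And>k. Suc k < 6 \<Longrightarrow> d (Suc k) - (commutator x ^^ k) (commutator y x) \<in> gam H (k + 3)"
    "mul e (commutator y x + x) = (\<Sum>k\<leftarrow>[0..<6]. mul (e choose k) (d k)) + mul e x"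
    by (rule expand_gam2[OF x z]) blast
  have "(\<Sum>k\<leftarrow>[0..<6]. mul (e choose k) (d k)) =
      (if 1 < (6::nat) then mul (e choose 1) (d 1) else 0) + (if p < 6 then mul (e choose p) (d p) else 0)"
  proof (rule sum_list_two)
    fix k :: nat assume k: "k < 6" "k \<noteq> 1" "k \<noteq> p"
    show "mul (e choose k) (d k) = 0"
    proof (cases "k = 0")
      case False
      \<comment> \<open>As 2p >= 6, no multiple of p other than p itself lies among 1, ...,
        5.\<close>
      have "\<not> p dvd k"
      proof
        assume "p dvd k"
        then obtain m where "k = p * m" by auto
        moreover have "m \<noteq> 0" "m \<noteq> 1" using False k calculation by auto
        ultimately have "p * 2 \<le> k" by (metis One_nat_def Suc_1 less_2_cases_iff mult_le_mono2 not_less)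
        then show False using p_ge_3 k by simp
      qed
      then show ?thesis using choose_killed[OF _ _ d(3)[OF k(1)]] k False by simp
    qed (simp add: d(1))
  qed (use p_ge_3 in simp)
  moreover have "(\<Sum>k\<leftarrow>[0..<6]. mul (e choose k) (d k)) = 0"
    using d(5) unfolding conj_central[OF x y] by (metis add_0 add_right_cancel)
  ultimately have 1: "mul e (commutator y x) + (if p < 6 then mul r (d p) else 0) = 0"
    using d(2) by simp
  have ad: "(commutator x ^^ (p - 1)) (commutator y x) \<in> gam H (Suc p)"
    using ad_gam[OF x z, of "p - 1"] p_ge_3 by simp
  show ?thesis
  proof (cases "p < 6")
    case True
    have "mul r (d p) = mul r ((commutator x ^^ (p - 1)) (commutator y x))"
      by (rule lin_cong[OF H lin_mul_r _ ad])
        (use True d(3)[of p] d(4)[of "p - 1"] p_ge_3 in simp_all)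
    then show ?thesis using 1 True by simp
  next
    case False
    then have "7 \<le> Suc p" by simp
    then show ?thesis using gam_eq_0[OF ad] 1 False by simp
  qed
qed

lemma lin_ad:
  "lin H (m + j) T \<Longrightarrow> x \<in> H \<Longrightarrow> lin H j (\<lambda>u. T ((commutator x ^^ m) u))"
proof (induction m arbitrary: T)
  case (Suc m)
  have "lin H (m + j) (\<lambda>u. T (commutator x u))"
    by (rule lin_commutator_right[OF H Suc.prems(1), of x 1]) (use Suc.prems(2) in auto)
  from Suc.IH[OF this Suc.prems(2)] show ?case by simp
qed simp

end

section \<open>Differences of sequences with values in an abelian subgroup\<close>

lemma fdiff_mem: "subgrp C \<Longrightarrow> (\<And>n. f n \<in> C) \<Longrightarrow> fdiff f n \<in> C"
  unfolding fdiff_def by (intro subgrp_diff) auto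

lemma fdiff_const [simp]: "fdiff (\<lambda>n. c) = (\<lambda>n. 0)"
  by (simp add: fdiff_def)

context
  fixes C :: "'g::group_add set"
  assumes C: "subgrp C" and comm: "\<And>u v. u \<in> C \<Longrightarrow> v \<in> C \<Longrightarrow> u + v = v + u"
begin

lemma funpow_fdiff_add_abelian:
  "(\<And>n. f n \<in> C) \<Longrightarrow> (\<And>n. g n \<in> C) \<Longrightarrow>
    (fdiff ^^ m) (\<lambda>n. f n + g n) = (\<lambda>n. (fdiff ^^ m) f n + (fdiff ^^ m) g n)"
proof (induction m arbitrary: f g)
  case (Suc m)
  have "fdiff (\<lambda>n. f n + g n) = (\<lambda>n. fdiff f n + fdiff g n)"
  proof
    fix n
    have "g (Suc n) - g n \<in> C" using subgrp_diff[OF C] Suc.prems(2) by blast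
    then have "(g (Suc n) - g n) + - f n = - f n + (g (Suc n) - g n)"
      using comm subgrp_uminus[OF C] Suc.prems(1) by blast
    then show "fdiff (\<lambda>n. f n + g n) n = fdiff f n + fdiff g n"
      by (simp add: fdiff_def group_simps)
  qed
  then show ?case
    using Suc.IH[of "fdiff f" "fdiff g"] fdiff_mem[OF C] Suc.prems by (simp add: funpow_swap1)
qed simp

lemma fdiff_mul_index:
  assumes h: "\<And>n. h n \<in> C"
  shows "fdiff (\<lambda>n. mul n (h n)) = (\<lambda>n. h (Suc n) + mul n (fdiff h n))"
proof
  fix n
  have "mul n (h (Suc n) + - h n) = mul n (h (Suc n)) + mul n (- h n)"
    using comm[OF h subgrp_uminus[OF C h]] by (rule mul_add_commute)
  then show "fdiff (\<lambda>n. mul n (h n)) n = h (Suc n) + mul n (fdiff h n)"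
    by (simp add: fdiff_def group_simps mul_uminus)
qed

lemma funpow_fdiff_shift: "(fdiff ^^ m) (\<lambda>n. h (Suc n)) = (\<lambda>n. (fdiff ^^ m) h (Suc n))"
  by (induction m) (auto simp: fdiff_def)

text \<open>A factor n raises the degree by one and multiplies the constant top difference by the
  new degree, as differentiation does with powers. Iterated, this is where the factorial in
  \<open>polarization\<close> comes from.\<close>

lemma funpow_fdiff_mul_index:
  "(\<And>n. h n \<in> C) \<Longrightarrow> (fdiff ^^ m) h = (\<lambda>n. t) \<Longrightarrow>
    (fdiff ^^ Suc m) (\<lambda>n. mul n (h n)) = (\<lambda>n. mul (Suc m) t)"
proof (induction m arbitrary: h)
  case 0
  then show ?case using fdiff_mul_index[of h] by simp
next
  case (Suc m)
  have D: "fdiff h n \<in> C" for n by (rule fdiff_mem[OF C Suc.prems(1)])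
  have "(fdiff ^^ Suc (Suc m)) (\<lambda>n. mul n (h n)) = (fdiff ^^ Suc m) (\<lambda>n. h (Suc n) + mul n (fdiff h n))"
    unfolding funpow_Suc_right[of "Suc m"] comp_apply fdiff_mul_index[OF Suc.prems(1)] ..
  also have "\<dots> = (\<lambda>n. (fdiff ^^ Suc m) (\<lambda>n. h (Suc n)) n + (fdiff ^^ Suc m) (\<lambda>n. mul n (fdiff h n)) n)"
    by (rule funpow_fdiff_add_abelian) (auto intro: Suc.prems(1) subgrp_mul[OF C D])
  also have "(fdiff ^^ Suc m) (\<lambda>n. h (Suc n)) = (\<lambda>n. t)"
    unfolding funpow_fdiff_shift Suc.prems(2) ..
  also have "(fdiff ^^ Suc m) (\<lambda>n. mul n (fdiff h n)) = (\<lambda>n. mul (Suc m) t)"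
    by (rule Suc.IH[OF D]) (use Suc.prems(2) in \<open>simp only: funpow_Suc_right comp_apply\<close>)
  finally show ?case by simp
qed

end

section \<open>Polarization and the derived subgroup\<close>

context central_powers
begin

text \<open>Polarization: the m-th difference in n extracts the leading coefficient of the
  polynomial in n obtained by expanding the m-fold action of y + n x.\<close>
lemma polarization:
  assumes x: "x \<in> H" and y: "y \<in> H" and w: "w \<in> gam H j"
  shows "lin H (m + j) T \<Longrightarrow> (fdiff ^^ m) (\<lambda>n. T ((commutator (y + mul n x) ^^ m) w))
    = (\<lambda>n. mul (fact m) (T ((commutator x ^^ m) w)))"
proof (induction m arbitrary: T)
  case (Suc m)
  note T = Suc.prems
  let ?k = "Suc m + j"
  have nx: "mul n x \<in> H" for n by (rule subgrp_mul[OF H x])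
  have x1: "x \<in> gam H 1" and y1: "y \<in> gam H 1" and nx1: "mul n x \<in> gam H 1" for n
    using x y nx by simp_all
  have L: "lin H (m + j) (\<lambda>u. T (commutator a u))" if "a \<in> gam H 1" for a
    by (rule lin_commutator_right[OF H T that]) simp
  have T1: "lin H (1 + (m + j)) T" using T by simp
  define u where "u n = (commutator (y + mul n x) ^^ m) w" for n
  have u: "u n \<in> gam H (m + j)" for n
    unfolding u_def by (rule ad_gam[OF subgrp_add[OF H y nx] w])
  \<comment> \<open>The difference calculus above needs commuting values; the image of
    \<open>T\<close> is an abelian subgroup containing all of them.\<close>
  let ?C = "T ` gam H ?k"
  have C: "subgrp ?C"
    unfolding subgrp_def
  proof (intro conjI ballI)
    note G = subgrp_gam[OF H, of ?k]
    show "0 \<in> ?C" using lin_zero[OF H T] subgrp_zero[OF G] by (metis imageI)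
    show "a + b \<in> ?C" if "a \<in> ?C" "b \<in> ?C" for a b
      using that lin_add[OF T] subgrp_add[OF G] by (auto simp del: add_Suc) (metis imageI)
    show "- a \<in> ?C" if "a \<in> ?C" for a
      using that lin_uminus[OF H T] subgrp_uminus[OF G] by (auto simp del: add_Suc) (metis imageI)
  qed
  have comm: "a + b = b + a" if "a \<in> ?C" "b \<in> ?C" for a b
    using that lin_commute[OF T] by blast
  have mem: "T (commutator a (u n)) \<in> ?C" if "a \<in> gam H 1" for a n
    using commutator_gam[OF H that u[of n]] by simp
  let ?g = "\<lambda>n. T (commutator y (u n))" and ?h = "\<lambda>n. T (commutator x (u n))"
  \<comment> \<open>Only the outermost commutator is split. The part with \<open>y\<close> has one
    degree less and disappears under \<open>Suc m\<close> differences; the part with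
    \<open>x\<close> carries the factor n and contributes the new factor
    \<open>Suc m\<close>.\<close>
  have eq: "(\<lambda>n. T ((commutator (y + mul n x) ^^ Suc m) w)) = (\<lambda>n. ?g n + mul n (?h n))"
  proof
    fix n
    have "T ((commutator (y + mul n x) ^^ Suc m) w) = T (commutator (y + mul n x) (u n))"
      by (simp add: u_def)
    also have "\<dots> = ?g n + T (commutator (mul n x) (u n))"
      by (rule lin_commutator_add_left[OF H T1 y1 nx1 u])
    also have "T (commutator (mul n x) (u n)) = mul n (?h n)"
      by (rule lin_commutator_mul_left[OF H T1 x1 u])
    finally show "T ((commutator (y + mul n x) ^^ Suc m) w) = ?g n + mul n (?h n)" .
  qed
  have "(fdiff ^^ m) ?g = (\<lambda>n. mul (fact m) (T (commutator y ((commutator x ^^ m) w))))"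
    unfolding u_def by (rule Suc.IH[OF L[OF y1]])
  then have g: "(fdiff ^^ Suc m) ?g = (\<lambda>n. 0)" by simp
  have "(fdiff ^^ m) ?h = (\<lambda>n. mul (fact m) (T (commutator x ((commutator x ^^ m) w))))"
    unfolding u_def by (rule Suc.IH[OF L[OF x1]])
  then have h: "(fdiff ^^ Suc m) (\<lambda>n. mul n (?h n))
      = (\<lambda>n. mul (Suc m) (mul (fact m) (T (commutator x ((commutator x ^^ m) w)))))"
    using funpow_fdiff_mul_index[where C = ?C and h = ?h, OF C comm mem[OF x1]] by blast
  have "(fdiff ^^ Suc m) (\<lambda>n. ?g n + mul n (?h n))
      = (\<lambda>n. (fdiff ^^ Suc m) ?g n + (fdiff ^^ Suc m) (\<lambda>n. mul n (?h n)) n)"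
    by (rule funpow_fdiff_add_abelian[OF C comm mem[OF y1] subgrp_mul[OF C mem[OF x1]]])
  then show ?case unfolding eq g h
    by (simp only: add_0 fact_Suc of_nat_id mul_mult funpow.simps comp_apply)
qed simp

lemma e_killed_commutator:
  assumes x: "x \<in> H" and y: "y \<in> H" shows "mul e (commutator y x) = 0"
proof -
  define w where "w = commutator x y"
  have w: "w \<in> gam H 2" unfolding w_def
    using commutator_gam[OF H, of x 1 y 1] x y by (simp add: numeral_2_eq_2)
  have L: "lin H (p - 1 + 2) (mul r)" using lin_mul_r p_ge_3 by (simp add: numeral_2_eq_2)
  let ?t = "mul r ((commutator x ^^ (p - 1)) w)"
  have "mul r ((commutator (y + mul k x) ^^ (p - 1)) w) = - mul e w" for k
  proof -
    have "commutator x (mul k x) = 0"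
      unfolding commutator_eq_0_iff by (rule commutes_mul[symmetric]) simp
    then have "commutator x (y + mul k x) = w" by (simp add: w_def commutator_add_right)
    then show ?thesis
      using commutator_relation[OF subgrp_add[OF H y subgrp_mul[OF H x, of k]] x]
      by (simp add: minus_unique)
  qed
  then have "(fdiff ^^ (p - 1)) (\<lambda>k. mul r ((commutator (y + mul k x) ^^ (p - 1)) w)) = (\<lambda>k. 0)"
    using p_ge_3 by (cases "p - 1") (simp_all add: funpow_swap1)
  then have "(\<lambda>k::nat. mul (fact (p - 1)) ?t) = (\<lambda>k. 0)"
    unfolding polarization[OF x y w L] .
  then have "mul (fact (p - 1)) ?t = 0" by metis
  moreover have "mul e ?t = 0"
    by (rule r_e_killed[OF _ ad_gam[OF x w]]) (use p_ge_3 in simp)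
  moreover have "coprime (fact (p - 1)) e"
  proof -
    have "\<not> p dvd fact (p - 1)" using p(1) p_ge_3 by (simp add: prime_dvd_fact_iff)
    then have "coprime p (fact (p - 1))" by (rule prime_imp_coprime_nat[OF p(1)])
    then show ?thesis by (simp add: coprime_commute)
  qed
  ultimately have "?t = 0" using mul_coprime_eq_0[of "fact (p - 1)" e ?t] by blast
  \<comment> \<open>Back to the original pair: there \<open>commutator y x = - w\<close>, so the
    \<open>r\<close>-term of its relation is \<open>- ?t\<close>, which is 0.\<close>
  moreover have "mul r ((commutator x ^^ (p - 1)) (- w)) = - ?t"
    by (rule lin_uminus[OF H lin_ad[OF L x] w])
  ultimately show ?thesis
    using commutator_relation[OF x y] by (simp add: w_def uminus_commutator)
qed

theorem e_killed_derived: "u \<in> gam H 2 \<Longrightarrow> mul e u = 0"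
proof -
  let ?S = "{c \<in> gam H 2. mul e c = 0}"
  note G = subgrp_gam[OF H, of 2]
  have add: "mul e (u + v) = 0" if u: "u \<in> gam H 2" "mul e u = 0" and v: "v \<in> gam H 2" "mul e v = 0" for u v
  proof -
    \<comment> \<open>Coefficient k lies in \<open>gam H (2 * k)\<close>, so only k = 2 and k = 3
      remain besides k = 1. A coefficient \<open>e choose 3\<close> not divisible by
      \<open>e\<close> can occur only for p = 3, and then \<open>r_killed_6\<close> applies.\<close>
    obtain d where d: "d 0 = 0" "d 1 = u" "\<And>k. k < 4 \<Longrightarrow> d k \<in> gam H (k * 2)"
      "mul e (u + v) = (\<Sum>k\<leftarrow>[0..<4]. mul (e choose k) (d k)) + mul e v"
      by (rule expand_gam_add[OF u(1) v(1), of 4]) auto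
    have 2: "mul (e choose 2) (d 2) = 0"
      by (rule choose_killed[OF _ _ d(3)]) (use p_ge_3 in \<open>auto dest: dvd_imp_le\<close>)
    have 3: "mul (e choose 3) (d 3) = 0"
    proof (cases "p = 3")
      case True
      then show ?thesis using r_killed_6[OF True] d(3)[of 3] by simp
    next
      case False
      then show ?thesis
        by (intro choose_killed[OF _ _ d(3)]) (use p_ge_3 in \<open>auto dest: dvd_imp_le\<close>)
    qed
    show ?thesis unfolding d(4) using d(1,2) 2 3 u v by (simp add: eval_nat_numeral)
  qed
  have "subgrp ?S"
    unfolding subgrp_def using add subgrpD[OF G] by (auto simp: mul_uminus)
  moreover have "commutator u y \<in> ?S" if u: "u \<in> H" and y: "y \<in> H" for u y
    using e_killed_commutator[OF y u] commutator_gam[OF H, of u 1 y 1] u y by (simp add: numeral_2_eq_2)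
  ultimately have "gen_by {commutator u y |u y. u \<in> H \<and> y \<in> H} \<subseteq> ?S"
    by (intro gen_by_least) auto
  moreover have "gam H 2 = gen_by {commutator u y |u y. u \<in> H \<and> y \<in> H}"
    by (simp add: numeral_2_eq_2 gam.simps(3))
  ultimately show "u \<in> gam H 2 \<Longrightarrow> mul e u = 0" by blast
qed

end

section \<open>The group of bijections of a type\<close>

text \<open>The central extension of G is realised inside this type, so that the results on type class
  groups apply to it although G itself is given by a carrier set.\<close>
typedef 'x bijection = "{f :: 'x \<Rightarrow> 'x. bij f}" morphisms apply_bij Bij
  by (rule exI[of _ id]) simp

lemma bij_apply_bij: "bij (apply_bij f)"
  using apply_bij[of f] by simp

instantiation bijection :: (type) group_add
begin

definition "0 = Bij id"
definition "f + g = Bij (apply_bij f \<circ> apply_bij g)"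
definition "- f = Bij (inv_into UNIV (apply_bij f))"
definition "f - g = f + - (g :: 'a bijection)"

lemma apply_zero: "apply_bij 0 = id"
  by (simp add: zero_bijection_def Bij_inverse)

lemma apply_add: "apply_bij (f + g) = apply_bij f \<circ> apply_bij g"
  by (simp add: plus_bijection_def Bij_inverse bij_apply_bij bij_comp)

lemma apply_uminus: "apply_bij (- f) = inv_into UNIV (apply_bij f)"
  by (simp add: uminus_bijection_def Bij_inverse bij_apply_bij bij_imp_bij_inv)

instance
proof
  fix f g h :: "'a bijection"
  show "f + g + h = f + (g + h)"
    by (simp add: apply_bij_inject[symmetric] apply_add comp_assoc)
  show "0 + f = f" "f + 0 = f"
    by (simp_all add: apply_bij_inject[symmetric] apply_add apply_zero)
  show "- f + f = 0"
    using bij_apply_bij[of f]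
    by (simp add: apply_bij_inject[symmetric] apply_add apply_zero apply_uminus bij_is_inj)
  show "f + - g = f - g" by (simp add: minus_bijection_def)
qed

end

declare plus_fun_apply [simp del] zero_fun_apply [simp del] minus_apply [simp del] uminus_apply [simp del]

lemmas pointwise = plus_fun_apply zero_fun_apply minus_apply uminus_apply

section \<open>Low-dimensional bar chains\<close>

definition int_mul :: "int \<Rightarrow> 'x::group_add \<Rightarrow> 'x" where
  "int_mul k x = (if k \<ge> 0 then mul (nat k) x else - mul (nat (- k)) x)"

lemma int_mul_plus_1: "int_mul (k + 1) x = int_mul k x + x"
proof -
  have neg: "int_mul (- int m) x = - mul m x" for m
    by (cases m) (simp_all add: int_mul_def nat_add_distrib)
  consider "k \<ge> 0" | m where "k = - int (Suc m)"
    by (cases k rule: int_cases) auto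
  then show ?thesis
  proof cases
    case 1
    then have "nat (k + 1) = Suc (nat k)" by simp
    then show ?thesis using 1 by (simp add: int_mul_def mul_Suc2 del: mul.simps)
  next
    case 2
    have "- mul m x = - mul (Suc m) x + x" by (simp add: group_simps)
    moreover have "k + 1 = - int m" using 2 by simp
    ultimately show ?thesis using neg[of m] neg[of "Suc m"] 2 by metis
  qed
qed

locale finite_bar = group G for G :: "('a, 'b) monoid_scheme" (structure) +
  assumes fin: "finite (carrier G)"
begin

lemma finite_bar_basis: "finite (bar_basis G n)"
proof -
  have "bar_basis G n = {xs. set xs \<subseteq> carrier G \<and> length xs = n}" by (auto simp: bar_basis_def)
  then show ?thesis using finite_lists_length_eq[OF fin] by simp
qed

lemma boundary_add: "boundary G n (c + d) = boundary G n c + boundary G n d"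
  by (rule ext) (simp add: boundary_def pointwise distrib_right sum.distrib)

lemma boundary_diff: "boundary G n (c - d) = boundary G n c - boundary G n d"
  by (rule ext) (simp add: boundary_def pointwise left_diff_distrib sum_subtractf)

lemma boundary_0: "boundary G n 0 = 0"
  by (rule ext) (simp add: boundary_def pointwise)

lemma boundary_basis_vec:
  assumes "xs \<in> bar_basis G n" shows "boundary G n (basis_vec xs) = bar_bd G n xs"
proof
  fix ys
  have "boundary G n (basis_vec xs) ys = (\<Sum>zs\<in>bar_basis G n. if zs = xs then bar_bd G n zs ys else 0)"
    unfolding boundary_def basis_vec_def by (intro sum.cong) auto
  then show "boundary G n (basis_vec xs) ys = bar_bd G n xs ys"
    using assms finite_bar_basis[of n] by (simp add: sum.delta)
qed

lemma basis_vec_chains: "xs \<in> bar_basis G n \<Longrightarrow> basis_vec xs \<in> chains G n"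
  by (auto simp: chains_def basis_vec_def)

lemma chains_add: "c \<in> chains G n \<Longrightarrow> d \<in> chains G n \<Longrightarrow> c + d \<in> chains G n"
  and chains_diff: "c \<in> chains G n \<Longrightarrow> d \<in> chains G n \<Longrightarrow> c - d \<in> chains G n"
  and chains_0: "0 \<in> chains G n"
  by (auto simp: chains_def pointwise)

text \<open>Induction on the sum of the absolute values of the coefficients; negative coefficients
  force the subtraction case.\<close>

lemma chains_induct [consumes 1, case_names zero add diff]:
  assumes c: "c \<in> chains G n" and 0: "P 0"
    and add: "\<And>c xs. c \<in> chains G n \<Longrightarrow> xs \<in> bar_basis G n \<Longrightarrow> P c \<Longrightarrow> P (c + basis_vec xs)"
    and diff: "\<And>c xs. c \<in> chains G n \<Longrightarrow> xs \<in> bar_basis G n \<Longrightarrow> P c \<Longrightarrow> P (c - basis_vec xs)"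
  shows "P c"
  using c
proof (induction "\<Sum>xs\<in>bar_basis G n. nat \<bar>c xs\<bar>" arbitrary: c rule: less_induct)
  case less
  show ?case
  proof (cases "c = 0")
    case False
    then obtain xs where xs: "c xs \<noteq> 0" by (auto simp: fun_eq_iff pointwise)
    then have b: "xs \<in> bar_basis G n" using less.prems by (auto simp: chains_def)
    have smaller: "P d" if d: "d \<in> chains G n" and "\<And>ys. ys \<noteq> xs \<Longrightarrow> d ys = c ys" "\<bar>d xs\<bar> < \<bar>c xs\<bar>" for d
    proof (rule less.hyps[OF _ d])
      show "(\<Sum>xs\<in>bar_basis G n. nat \<bar>d xs\<bar>) < (\<Sum>xs\<in>bar_basis G n. nat \<bar>c xs\<bar>)"
      proof (rule sum_strict_mono_ex1[OF finite_bar_basis])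
        show "\<forall>ys\<in>bar_basis G n. nat \<bar>d ys\<bar> \<le> nat \<bar>c ys\<bar>"
          using that(2,3) by (metis less_imp_le nat_mono order_refl)
        show "\<exists>ys\<in>bar_basis G n. nat \<bar>d ys\<bar> < nat \<bar>c ys\<bar>"
          using b that(3) by (intro bexI[of _ xs]) auto
      qed
    qed
    note B = basis_vec_chains[OF b]
    show ?thesis
    proof (cases "c xs > 0")
      case True
      have "P (c - basis_vec xs)"
        by (rule smaller[OF chains_diff[OF less.prems B]]) (use True in \<open>auto simp: basis_vec_def pointwise\<close>)
      from add[OF chains_diff[OF less.prems B] b this] show ?thesis by simp
    next
      case False
      have "P (c + basis_vec xs)"
        by (rule smaller[OF chains_add[OF less.prems B]]) (use False xs in \<open>auto simp: basis_vec_def pointwise\<close>)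
      from diff[OF chains_add[OF less.prems B] b this] show ?thesis by simp
    qed
  qed (use 0 in simp)
qed

lemma bar_bd_2: "bar_bd G 2 [a, b] = basis_vec [b] - basis_vec [a \<otimes> b] + basis_vec [a]"
proof -
  have "{1..<2} = {1::nat}" by auto
  then show ?thesis by (intro ext) (simp add: bar_bd_def pointwise)
qed

lemma bar_bd_3:
  "bar_bd G 3 [a, b, c] = basis_vec [b, c] - basis_vec [a \<otimes> b, c] + basis_vec [a, b \<otimes> c] - basis_vec [a, b]"
proof -
  have "{1..<3} = {1, 2::nat}" by auto
  then show ?thesis by (intro ext) (simp add: bar_bd_def pointwise)
qed

lemma bar_basis_2E:
  assumes "xs \<in> bar_basis G 2"
  obtains a b where "xs = [a, b]" "a \<in> carrier G" "b \<in> carrier G"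
  using assms by (auto simp: bar_basis_def length_Suc_conv eval_nat_numeral)

lemma bar_basis_3E:
  assumes "xs \<in> bar_basis G 3"
  obtains a b c where "xs = [a, b, c]" "a \<in> carrier G" "b \<in> carrier G" "c \<in> carrier G"
  using assms by (auto simp: bar_basis_def length_Suc_conv eval_nat_numeral)

lemma bar_basis_2I: "a \<in> carrier G \<Longrightarrow> b \<in> carrier G \<Longrightarrow> [a, b] \<in> bar_basis G 2"
  and bar_basis_3I: "a \<in> carrier G \<Longrightarrow> b \<in> carrier G \<Longrightarrow> c \<in> carrier G \<Longrightarrow> [a, b, c] \<in> bar_basis G 3"
  by (auto simp: bar_basis_def)

abbreviation "B2 \<equiv> boundaries G 2"

lemma boundaries_2: "B2 = boundary G 3 ` chains G 3"
  by (simp add: boundaries_def numeral_3_eq_3 numeral_2_eq_2)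

lemma B2_0: "0 \<in> B2"
  unfolding boundaries_2 using boundary_0 chains_0 by (metis imageI)

lemma B2_add: "c \<in> B2 \<Longrightarrow> d \<in> B2 \<Longrightarrow> c + d \<in> B2"
  unfolding boundaries_2 using boundary_add chains_add by (auto simp flip: boundary_add)

lemma B2_diff: "c \<in> B2 \<Longrightarrow> d \<in> B2 \<Longrightarrow> c - d \<in> B2"
  unfolding boundaries_2 using boundary_diff chains_diff by (auto simp flip: boundary_diff)

lemma B2_uminus: "c \<in> B2 \<Longrightarrow> - c \<in> B2"
  using B2_diff[OF B2_0] by (metis diff_0)

lemma bd_3_in_B2:
  "a \<in> carrier G \<Longrightarrow> b \<in> carrier G \<Longrightarrow> c \<in> carrier G \<Longrightarrow> bar_bd G 3 [a, b, c] \<in> B2"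
  unfolding boundaries_2 using boundary_basis_vec[OF bar_basis_3I] basis_vec_chains[OF bar_basis_3I]
  by (metis imageI)

lemma boundary_boundary:
  assumes "c \<in> chains G 3"
  shows "boundary G 3 c \<in> chains G 2 \<and> boundary G 2 (boundary G 3 c) = 0"
proof -
  have bd: "bar_bd G 3 xs \<in> chains G 2 \<and> boundary G 2 (bar_bd G 3 xs) = 0" if "xs \<in> bar_basis G 3" for xs
    using that
  proof (rule bar_basis_3E)
    fix a b c assume abc: "xs = [a, b, c]" "a \<in> carrier G" "b \<in> carrier G" "c \<in> carrier G"
    show ?thesis
      unfolding abc(1) bar_bd_3 boundary_add boundary_diff using abc(2-)
      by (auto intro!: chains_add chains_diff basis_vec_chains bar_basis_2I
          simp: boundary_basis_vec bar_basis_2I bar_bd_2 m_assoc)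
  qed
  show ?thesis using assms
    by (induction rule: chains_induct)
      (use bd in \<open>auto simp: boundary_add boundary_diff boundary_0 boundary_basis_vec chains_0 intro: chains_add chains_diff\<close>)
qed

lemma B2_subset_cycles: "B2 \<subseteq> cycles G 2"
  using boundary_boundary by (auto simp: boundaries_2 cycles_def zero_fun_def)

section \<open>The universal central extension by 2-chains modulo boundaries\<close>

text \<open>\<open>u\<close> ranges over all integer-valued functions on lists, so the kernel of the
  extension is larger than chains modulo boundaries. It is still central, and an element of it is
  trivial only if it lies in \<open>B2\<close>.\<close>

definition coset :: "('a list \<Rightarrow> int) \<Rightarrow> ('a list \<Rightarrow> int) set" where
  "coset u = (\<lambda>b. u + b) ` B2"

lemma coset_eq_iff: "coset u = coset v \<longleftrightarrow> u - v \<in> B2"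
proof
  assume "coset u = coset v"
  then have "u \<in> coset v" using B2_0 unfolding coset_def by force
  then show "u - v \<in> B2" by (auto simp: coset_def)
next
  have sub: "coset u \<subseteq> coset v" if uv: "u - v \<in> B2" for u v
  proof
    fix w assume "w \<in> coset u"
    then obtain b where b: "b \<in> B2" "w = u + b" by (auto simp: coset_def)
    then have "w = v + ((u - v) + b)" by (simp add: algebra_simps)
    then show "w \<in> coset v" unfolding coset_def using B2_add[OF uv b(1)] by blast
  qed
  assume uv: "u - v \<in> B2"
  then have "v - u \<in> B2" using B2_uminus[OF uv] by simp
  then show "coset u = coset v" using sub uv by blast
qed

text \<open>The element (a, g) of the extension with cocycle [g,h] acts by left translation on pairs of a
  coset of the boundaries and a group element, and trivially elsewhere.\<close>
definition translation :: "('a list \<Rightarrow> int) \<Rightarrow> 'a \<Rightarrow> ('a list \<Rightarrow> int) set \<times> 'a \<Rightarrow> ('a list \<Rightarrow> int) set \<times> 'a" where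
  "translation a g = (\<lambda>(C, h). if C \<in> range coset \<and> h \<in> carrier G
     then ((\<lambda>c. a + basis_vec [g, h] + c) ` C, g \<otimes> h) else (C, h))"

lemma translation_coset:
  "h \<in> carrier G \<Longrightarrow> translation a g (coset u, h) = (coset (a + basis_vec [g, h] + u), g \<otimes> h)"
  by (auto simp: translation_def coset_def image_image add.assoc)

lemma translation_outside: "\<not> (C \<in> range coset \<and> h \<in> carrier G) \<Longrightarrow> translation a g (C, h) = (C, h)"
  by (auto simp: translation_def)

lemma translation_eqI:
  assumes "\<And>u h. h \<in> carrier G \<Longrightarrow> f (coset u, h) = translation a g (coset u, h)"
    and "\<And>C h. \<not> (C \<in> range coset \<and> h \<in> carrier G) \<Longrightarrow> f (C, h) = (C, h)"
  shows "f = translation a g"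
proof
  fix x :: "('a list \<Rightarrow> int) set \<times> 'a"
  obtain C h where x: "x = (C, h)" by (cases x)
  show "f x = translation a g x"
    using assms translation_outside[of C h a g] unfolding x by (cases "C \<in> range coset \<and> h \<in> carrier G") auto
qed

text \<open>The cocycle identity: the two sides differ by the boundary of [g, k, h], which is
  invisible on cosets of \<open>B2\<close>.\<close>

lemma translation_comp:
  assumes g: "g \<in> carrier G" and k: "k \<in> carrier G"
  shows "translation a g \<circ> translation b k = translation (a + b + basis_vec [g, k]) (g \<otimes> k)"
proof (rule translation_eqI)
  fix u h assume h: "h \<in> carrier G"
  have "(a + basis_vec [g, k \<otimes> h] + (b + basis_vec [k, h] + u))
      - (a + b + basis_vec [g, k] + basis_vec [g \<otimes> k, h] + u) = bar_bd G 3 [g, k, h]"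
    unfolding bar_bd_3 by (simp add: algebra_simps)
  then have "coset (a + basis_vec [g, k \<otimes> h] + (b + basis_vec [k, h] + u))
      = coset (a + b + basis_vec [g, k] + basis_vec [g \<otimes> k, h] + u)"
    unfolding coset_eq_iff using bd_3_in_B2[OF g k h] by simp
  then show "(translation a g \<circ> translation b k) (coset u, h)
     = translation (a + b + basis_vec [g, k]) (g \<otimes> k) (coset u, h)"
    using g k h by (simp add: translation_coset m_assoc)
qed (simp add: translation_outside)

text \<open>The cocycle is not normalized; the differences are the boundary of [1,1,h] and minus the
  boundary of [h,1,1]. This is why the neutral element of the extension, and with it
  \<open>embed\<close>, carries the correction by [1,1].\<close>

lemma unit_cocycle:
  assumes h: "h \<in> carrier G"
  shows "basis_vec [\<one>, h] - basis_vec [\<one>, \<one>] \<in> B2" "basis_vec [h, \<one>] - basis_vec [\<one>, \<one>] \<in> B2"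
proof -
  show "basis_vec [\<one>, h] - basis_vec [\<one>, \<one>] \<in> B2"
    using bd_3_in_B2[OF one_closed one_closed h] h unfolding bar_bd_3 by simp
  have "- (bar_bd G 3 [h, \<one>, \<one>]) \<in> B2" by (intro B2_uminus bd_3_in_B2 h one_closed)
  then show "basis_vec [h, \<one>] - basis_vec [\<one>, \<one>] \<in> B2"
    unfolding bar_bd_3 using h by simp
qed

lemma translation_cong: "a - a' \<in> B2 \<Longrightarrow> translation a g = translation a' g"
  by (rule translation_eqI) (auto simp: translation_coset coset_eq_iff translation_outside)

lemma translation_id: "translation (- basis_vec [\<one>, \<one>]) \<one> = id"
proof (rule translation_eqI[symmetric])
  fix u h assume h: "h \<in> carrier G"
  have "coset u = coset (- basis_vec [\<one>, \<one>] + basis_vec [\<one>, h] + u)"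
    unfolding coset_eq_iff using B2_uminus[OF unit_cocycle(1)[OF h]]
    by (simp add: algebra_simps add_uminus_conv_diff)
  then show "id (coset u, h) = translation (- basis_vec [\<one>, \<one>]) \<one> (coset u, h)"
    unfolding translation_coset[OF h] using h by (simp only: id_apply l_one)
qed simp

lemma translation_left_inverse:
  assumes g: "g \<in> carrier G"
  shows "\<exists>a'. translation a' (inv g) \<circ> translation a g = id"
proof -
  \<comment> \<open>The witness solves a' + a + [inv g, g] = - [1,1], the first component of the
    neutral element.\<close>
  have "translation (- a - basis_vec [inv g, g] - basis_vec [\<one>, \<one>]) (inv g) \<circ> translation a g = id"
    unfolding translation_comp[OF inv_closed[OF g] g] translation_id[symmetric]
    using g by (intro arg_cong2[of _ _ _ _ translation]) auto
  then show ?thesis by blast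
qed

lemma translation_inverse:
  assumes g: "g \<in> carrier G"
  shows "\<exists>a'. translation a' (inv g) \<circ> translation a g = id \<and> translation a g \<circ> translation a' (inv g) = id"
proof -
  obtain a' where a': "translation a' (inv g) \<circ> translation a g = id"
    using translation_left_inverse[OF g] by blast
  obtain a'' where a'': "translation a'' (inv (inv g)) \<circ> translation a' (inv g) = id"
    using translation_left_inverse[OF inv_closed[OF g]] by blast
  have "translation a'' (inv (inv g)) = translation a g"
    using a' a'' by (metis comp_assoc comp_id id_comp)
  then show ?thesis using a' a'' by auto
qed

lemma bij_translation: "g \<in> carrier G \<Longrightarrow> bij (translation a g)"
  using translation_inverse[of g a] o_bij by blast

definition ext :: "('a list \<Rightarrow> int) \<Rightarrow> 'a \<Rightarrow> (('a list \<Rightarrow> int) set \<times> 'a) bijection" where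
  "ext a g = Bij (translation a g)"

lemma apply_ext: "g \<in> carrier G \<Longrightarrow> apply_bij (ext a g) = translation a g"
  by (simp add: ext_def Bij_inverse bij_translation)

lemma ext_add:
  "g \<in> carrier G \<Longrightarrow> k \<in> carrier G \<Longrightarrow> ext a g + ext b k = ext (a + b + basis_vec [g, k]) (g \<otimes> k)"
  by (simp add: apply_bij_inject[symmetric] apply_add apply_ext translation_comp)

lemma ext_zero: "ext (- basis_vec [\<one>, \<one>]) \<one> = 0"
  by (simp add: apply_bij_inject[symmetric] apply_zero apply_ext translation_id)

lemma ext_uminus: "g \<in> carrier G \<Longrightarrow> \<exists>a'. - ext a g = ext a' (inv g)"
proof -
  assume g: "g \<in> carrier G"
  then obtain a' where "translation a g \<circ> translation a' (inv g) = id"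
    using translation_inverse by blast
  then have "ext a g + ext a' (inv g) = 0"
    using g by (simp add: apply_bij_inject[symmetric] apply_add apply_zero apply_ext)
  then show ?thesis using minus_unique by blast
qed

definition embed :: "('a list \<Rightarrow> int) \<Rightarrow> (('a list \<Rightarrow> int) set \<times> 'a) bijection" where
  "embed a = ext (a - basis_vec [\<one>, \<one>]) \<one>"

lemma ext_cong: "g \<in> carrier G \<Longrightarrow> a - a' \<in> B2 \<Longrightarrow> ext a g = ext a' g"
  by (simp add: apply_bij_inject[symmetric] apply_ext translation_cong)

lemma embed_ext:
  assumes k: "k \<in> carrier G"
  shows "embed a + ext b k = ext (a + b) k" "ext b k + embed a = ext (a + b) k"
proof -
  have "ext (a - basis_vec [\<one>, \<one>] + b + basis_vec [\<one>, k]) k = ext (a + b) k"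
    by (rule ext_cong[OF k]) (use unit_cocycle(1)[OF k] in \<open>simp add: algebra_simps\<close>)
  then show "embed a + ext b k = ext (a + b) k" using k by (simp add: embed_def ext_add)
  have "ext (b + (a - basis_vec [\<one>, \<one>]) + basis_vec [k, \<one>]) k = ext (a + b) k"
    by (rule ext_cong[OF k]) (use unit_cocycle(2)[OF k] in \<open>simp add: algebra_simps\<close>)
  then show "ext b k + embed a = ext (a + b) k" using k by (simp add: embed_def ext_add)
qed

lemma embed_zero: "embed 0 = 0"
  unfolding embed_def using ext_zero by simp

lemma embed_add: "embed (a + b) = embed a + embed b"
  unfolding embed_def[of b] embed_ext(1)[OF one_closed] by (simp add: embed_def algebra_simps)

lemma embed_one: "ext a \<one> = embed (a + basis_vec [\<one>, \<one>])"
  by (simp add: embed_def)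

lemma embed_mul: "embed (mul m a) = mul m (embed a)"
  by (induction m) (simp_all add: embed_zero embed_add)

lemma embed_eq_0: "embed a = 0 \<Longrightarrow> a \<in> B2"
proof -
  assume "embed a = 0"
  \<comment> \<open>At this point the term [1,1] of the cocycle cancels the correction in
    \<open>embed\<close>, so \<open>a\<close> itself can be read off.\<close>
  then have "translation (a - basis_vec [\<one>, \<one>]) \<one> (coset 0, \<one>) = (coset 0, \<one>)"
    by (simp add: apply_bij_inject[symmetric] apply_zero apply_ext embed_def)
  then show "a \<in> B2" by (simp add: translation_coset coset_eq_iff)
qed

definition ext_group :: "(('a list \<Rightarrow> int) set \<times> 'a) bijection set" where
  "ext_group = {ext a g | a g. g \<in> carrier G}"

lemma ext_in_group: "g \<in> carrier G \<Longrightarrow> ext a g \<in> ext_group"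
  by (auto simp: ext_group_def)

lemma subgrp_ext_group: "subgrp ext_group"
  unfolding subgrp_def
proof (intro conjI ballI)
  show "0 \<in> ext_group" using ext_in_group[OF one_closed] ext_zero by metis
  show "x + y \<in> ext_group" if "x \<in> ext_group" "y \<in> ext_group" for x y
    using that by (auto simp: ext_group_def ext_add) (metis m_closed)
  show "- x \<in> ext_group" if "x \<in> ext_group" for x
    using that ext_uminus unfolding ext_group_def by (auto) (metis inv_closed)
qed

lemma embed_central: "x \<in> ext_group \<Longrightarrow> embed a + x = x + embed a"
  by (auto simp: ext_group_def embed_ext)

section \<open>The lower central series of the extension\<close>

lemma lower_central_subset: "lower_central G n \<subseteq> carrier G"
proof (induction n)
  case (Suc n)
  then show ?case unfolding lower_central.simps by (intro generate_incl) auto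
qed simp

lemma subgroup_lower_central: "subgroup (lower_central G n) G"
proof (cases n)
  case (Suc m)
  then show ?thesis using lower_central_subset[of m]
    by (auto intro!: generate_is_subgroup)
qed (simp add: subgroup_self)

text \<open>The projection to \<open>G\<close> maps commutators to commutators. The shift arises
  because \<open>lower_central\<close> counts from 0 and \<open>gam\<close> from 1; to bound the
  class this inclusion is enough.\<close>

lemma gam_ext_group: "gam ext_group (Suc n) \<subseteq> {ext a g | a g. g \<in> lower_central G n}"
proof (induction n)
  case 0
  show ?case by (auto simp: ext_group_def)
next
  case (Suc n)
  let ?T = "{ext a g | a g. g \<in> lower_central G (Suc n)}"
  interpret L: subgroup "lower_central G (Suc n)" G by (rule subgroup_lower_central)
  have "subgrp ?T"
    unfolding subgrp_def
  proof (intro conjI ballI)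
    show "0 \<in> ?T" unfolding ext_zero[symmetric] using L.one_closed by blast
    show "x + y \<in> ?T" if xy: "x \<in> ?T" "y \<in> ?T" for x y
    proof -
      obtain a g b k where "x = ext a g" "g \<in> lower_central G (Suc n)"
        "y = ext b k" "k \<in> lower_central G (Suc n)" using xy by blast
      then show ?thesis using ext_add[of g k a b] L.mem_carrier L.m_closed by blast
    qed
    show "- x \<in> ?T" if x: "x \<in> ?T" for x
    proof -
      obtain a g where "x = ext a g" "g \<in> lower_central G (Suc n)" using x by blast
      then show ?thesis using ext_uminus[of g a] L.mem_carrier L.m_inv_closed by blast
    qed
  qed
  moreover have "commutator x y \<in> ?T" if x: "x \<in> gam ext_group (Suc n)" and y: "y \<in> ext_group" for x y
  proof -
    obtain a g b k where x: "x = ext a g" "g \<in> lower_central G n" and y: "y = ext b k" "k \<in> carrier G"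
      using x y Suc by (auto simp: ext_group_def)
    have g: "g \<in> carrier G" using x(2) lower_central_subset by blast
    obtain a' b' where "- ext a g = ext a' (inv g)" "- ext b k = ext b' (inv k)"
      using ext_uminus g y(2) by metis
    then have "\<exists>c. commutator x y = ext c (g \<otimes> k \<otimes> inv g \<otimes> inv k)"
      unfolding commutator_def x(1) y(1) diff_conv_add_uminus using g y(2) by (simp add: ext_add) blast
    moreover have "g \<otimes> k \<otimes> inv g \<otimes> inv k \<in> lower_central G (Suc n)"
      unfolding lower_central.simps using x(2) y(2) by (intro generate.incl) blast
    ultimately show ?thesis by blast
  qed
  ultimately show ?case unfolding gam.simps by (intro gen_by_least) auto
qed

section \<open>Cycles are products of commutators in the extension\<close>

definition modulo_commutators (infix "\<doteq>" 50) where
  "x \<doteq> y \<longleftrightarrow> x - y \<in> gam ext_group 2"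

lemma mod_refl: "x \<doteq> x"
  unfolding modulo_commutators_def using subgrp_zero[OF subgrp_gam[OF subgrp_ext_group]] by simp

lemma mod_trans [trans]: "x \<doteq> y \<Longrightarrow> y \<doteq> z \<Longrightarrow> x \<doteq> z"
  unfolding modulo_commutators_def
  using subgrp_add[OF subgrp_gam[OF subgrp_ext_group], of "x - y" 2 "y - z"] by (simp add: group_simps)

lemma mod_sym: "x \<doteq> y \<Longrightarrow> y \<doteq> x"
  unfolding modulo_commutators_def
  using subgrp_uminus[OF subgrp_gam[OF subgrp_ext_group], of "x - y" 2] by (simp add: group_simps)

lemma mod_add: "x \<doteq> x' \<Longrightarrow> y \<doteq> y' \<Longrightarrow> x \<in> ext_group \<Longrightarrow> x + y \<doteq> x' + y'"
  unfolding modulo_commutators_def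
  using subgrp_add[OF subgrp_gam[OF subgrp_ext_group] gam_conj[OF subgrp_ext_group], of "y - y'" 2 x "x - x'"]
  by (simp add: group_simps)

lemma mod_cancel: "x + z \<doteq> y + z \<longleftrightarrow> x \<doteq> y"
  unfolding modulo_commutators_def by (simp add: group_simps)

lemma mod_commute: "x \<in> ext_group \<Longrightarrow> y \<in> ext_group \<Longrightarrow> x + y \<doteq> y + x"
  unfolding modulo_commutators_def
  using commutator_gam[OF subgrp_ext_group, of x 1 y 1]
  by (simp add: commutator_def group_simps numeral_2_eq_2)

lemma int_mul_in_group: "x \<in> ext_group \<Longrightarrow> int_mul k x \<in> ext_group"
  unfolding int_mul_def using subgrp_mul subgrp_uminus subgrp_ext_group by metis

text \<open>Modulo commutators this is the homomorphism on 1-chains that sends [g] to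
  \<open>ext 0 g\<close>; the list fixes an order of summation, as the extension is
  nonabelian.\<close>

definition lift_chain :: "'a list \<Rightarrow> ('a list \<Rightarrow> int) \<Rightarrow> (('a list \<Rightarrow> int) set \<times> 'a) bijection" where
  "lift_chain gs a = (\<Sum>g\<leftarrow>gs. int_mul (a [g]) (ext 0 g))"

lemma lift_chain_in_group: "set gs \<subseteq> carrier G \<Longrightarrow> lift_chain gs a \<in> ext_group"
  unfolding lift_chain_def
  by (induction gs) (auto intro!: subgrpD[OF subgrp_ext_group] int_mul_in_group ext_in_group)

lemma lift_chain_basis:
  assumes "set gs \<subseteq> carrier G" "distinct gs" "g \<in> set gs"
  shows "lift_chain gs (a + basis_vec [g]) \<doteq> lift_chain gs a + ext 0 g"
  using assms
proof (induction gs)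
  case (Cons k gs)
  have k: "int_mul z (ext 0 k) \<in> ext_group" for z using Cons.prems by (auto intro: int_mul_in_group ext_in_group)
  have rest: "lift_chain gs a \<in> ext_group" for a by (rule lift_chain_in_group) (use Cons.prems in auto)
  have eg: "ext 0 g \<in> ext_group" using Cons.prems by (auto intro: ext_in_group)
  have unfold: "lift_chain (k # gs) a = int_mul (a [k]) (ext 0 k) + lift_chain gs a" for a
    by (simp add: lift_chain_def)
  show ?case
  proof (cases "k = g")
    case True
    have "lift_chain gs (a + basis_vec [g]) = lift_chain gs a"
      unfolding lift_chain_def using Cons.prems True
      by (intro arg_cong[of _ _ sum_list] map_cong) (auto simp: basis_vec_def pointwise)
    then have "lift_chain (k # gs) (a + basis_vec [g])
        = int_mul (a [k]) (ext 0 k) + (ext 0 g + lift_chain gs a)"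
      unfolding unfold using True by (simp add: basis_vec_def pointwise int_mul_plus_1 add.assoc)
    also have "\<dots> \<doteq> int_mul (a [k]) (ext 0 k) + (lift_chain gs a + ext 0 g)"
      by (intro mod_add mod_refl mod_commute eg rest k)
    finally show ?thesis unfolding unfold by (simp add: add.assoc)
  next
    case False
    have "lift_chain (k # gs) (a + basis_vec [g])
        = int_mul (a [k]) (ext 0 k) + lift_chain gs (a + basis_vec [g])"
      unfolding unfold using False by (simp add: basis_vec_def pointwise)
    also have "\<dots> \<doteq> int_mul (a [k]) (ext 0 k) + (lift_chain gs a + ext 0 g)"
      by (intro mod_add mod_refl Cons.IH k) (use Cons.prems False in auto)
    finally show ?thesis unfolding unfold by (simp add: add.assoc)
  qed
qed simp

text \<open>Modulo commutators embed [g,h] = s g + s h - s (g h), where s = ext 0; hence embed factors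
  through the boundary map and cycles land in the derived subgroup.\<close>
lemma embed_cycle:
  assumes z: "z \<in> cycles G 2" shows "embed z \<in> gam ext_group 2"
proof -
  obtain gs where gs: "set gs = carrier G" "distinct gs"
    using finite_distinct_list[OF fin] by blast
  note W_basis = lift_chain_basis[OF equalityD1[OF gs(1)] gs(2), unfolded gs(1)]
  have W: "lift_chain gs a \<in> ext_group" for a by (rule lift_chain_in_group) (simp add: gs)
  \<comment> \<open>An equivalence, so that read backwards it also settles the subtraction case of
    \<open>chains_induct\<close>.\<close>
  have step: "embed (c + basis_vec xs) \<doteq> lift_chain gs (boundary G 2 (c + basis_vec xs))
      \<longleftrightarrow> embed c \<doteq> lift_chain gs (boundary G 2 c)" if xs: "xs \<in> bar_basis G 2" for c xs
  proof -
    obtain g h where gh: "xs = [g, h]" "g \<in> carrier G" "h \<in> carrier G" using xs by (rule bar_basis_2E)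
    let ?d = "boundary G 2 c" and ?s = "\<lambda>g. ext 0 g"
    have prod: "?s g + ?s h = embed (basis_vec xs) + ?s (g \<otimes> h)"
      using gh by (simp add: ext_add embed_ext)
    have eq: "boundary G 2 (c + basis_vec xs) + basis_vec [g \<otimes> h] = ?d + basis_vec [g] + basis_vec [h]"
      using gh unfolding boundary_add boundary_basis_vec[OF xs] by (simp add: bar_bd_2 algebra_simps)
    let ?w = "lift_chain gs (boundary G 2 (c + basis_vec xs))" and ?v = "lift_chain gs ?d"
    have "?w + ?s (g \<otimes> h) \<doteq> lift_chain gs (?d + basis_vec [g] + basis_vec [h])"
      unfolding eq[symmetric] by (rule mod_sym[OF W_basis]) (use gh in simp)
    also have "\<dots> \<doteq> lift_chain gs (?d + basis_vec [g]) + ?s h" by (rule W_basis[OF gh(3)])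
    also have "\<dots> \<doteq> ?v + ?s g + ?s h" unfolding mod_cancel by (rule W_basis[OF gh(2)])
    also have "?v + ?s g + ?s h = ?v + embed (basis_vec xs) + ?s (g \<otimes> h)"
      using prod by (simp add: add.assoc)
    finally have w: "?w \<doteq> ?v + embed (basis_vec xs)" unfolding mod_cancel .
    show ?thesis
      unfolding embed_add mod_cancel[of "embed c" "embed (basis_vec xs)" ?v, symmetric]
      using mod_trans[OF _ w] mod_trans[OF _ mod_sym[OF w]] by (rule iffI)
  qed
  have "embed c \<doteq> lift_chain gs (boundary G 2 c)" if "c \<in> chains G 2" for c
    using that
  proof (induction rule: chains_induct)
    case zero
    have "lift_chain gs 0 = 0" by (simp add: lift_chain_def int_mul_def pointwise sum_list_eq_0)
    then show ?case by (simp add: embed_zero boundary_0 mod_refl)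
  next
    case (add c xs)
    then show ?case using step by blast
  next
    case (diff c xs)
    then show ?case using step[of xs "c - basis_vec xs"] by simp
  qed
  moreover have "boundary G 2 z = 0" and "z \<in> chains G 2"
    using z by (simp_all add: cycles_def zero_fun_def)
  moreover have "lift_chain gs 0 = 0" by (simp add: lift_chain_def int_mul_def pointwise sum_list_eq_0)
  ultimately have "embed z \<doteq> 0" by metis
  then show ?thesis by (simp add: modulo_commutators_def)
qed

lemma mul_ext: "g \<in> carrier G \<Longrightarrow> \<exists>b. mul m (ext a g) = ext b (g [^] m)"
proof (induction m)
  case 0
  show ?case using ext_zero by (metis mul.simps(1) nat_pow_0)
next
  case (Suc m)
  then obtain b where "mul m (ext a g) = ext b (g [^] m)" by blast
  then show ?case using Suc.prems by (auto simp: mul_Suc2 ext_add simp del: mul.simps)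
qed

lemma cycle_multiple_boundary:
  assumes p: "Factorial_Ring.prime p" "odd p" and nil: "lower_central G 5 = {\<one>}"
    and exp: "\<And>x. x \<in> carrier G \<Longrightarrow> x [^] (p ^ n) = \<one>" and z: "z \<in> cycles G 2"
  shows "mul (p ^ n) z \<in> B2"
proof -
  \<comment> \<open>The sixth term lies over \<open>lower_central G 5\<close>, which is trivial,
    hence inside the central kernel; one more commutator gives 0.\<close>
  have six: "\<exists>a. u = embed a" if "u \<in> gam ext_group (Suc 5)" for u
    using gam_ext_group[of 5] that nil embed_one by auto
  have "gam ext_group 7 = gen_by {commutator u y |u y. u \<in> gam ext_group (Suc 5) \<and> y \<in> ext_group}"
    by (simp add: eval_nat_numeral gam.simps(3))
  also have "\<dots> \<subseteq> {0}"
  proof (rule gen_by_least)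
    show "subgrp {0 :: (('a list \<Rightarrow> int) set \<times> 'a) bijection}" by (simp add: subgrp_def)
    show "{commutator u y |u y. u \<in> gam ext_group (Suc 5) \<and> y \<in> ext_group} \<subseteq> {0}"
      using six embed_central by (auto simp: commutator_eq_0_iff) metis
  qed
  finally have 7: "gam ext_group 7 = {0}"
    using subgrp_zero[OF subgrp_gam[OF subgrp_ext_group]] by blast
  interpret central_powers ext_group p n
  proof
    show "mul (p ^ n) x + y = y + mul (p ^ n) x" if x: "x \<in> ext_group" and y: "y \<in> ext_group" for x y
    proof -
      obtain a g where "x = ext a g" "g \<in> carrier G" using x by (auto simp: ext_group_def)
      then obtain b where "mul (p ^ n) x = ext b \<one>" using mul_ext[of g "p ^ n" a] exp by auto
      then show ?thesis using embed_central[OF y] by (simp add: embed_one)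
    qed
  qed (use subgrp_ext_group 7 p in auto)
  have "embed (mul (p ^ n) z) = 0"
    unfolding embed_mul by (rule e_killed_derived[OF embed_cycle[OF z]])
  then show ?thesis by (rule embed_eq_0)
qed

section \<open>Exponents\<close>

lemma comm_group_cycle_group: "comm_group (cycle_group G 2)"
proof (rule comm_groupI)
  fix x y assume xy: "x \<in> carrier (cycle_group G 2)" "y \<in> carrier (cycle_group G 2)"
  then have "x + y \<in> cycles G 2"
    by (auto simp: cycle_group_def cycles_def boundary_add zero_fun_def[symmetric] intro: chains_add)
  then show "x \<otimes>\<^bsub>cycle_group G 2\<^esub> y \<in> carrier (cycle_group G 2)"
    by (simp add: cycle_group_def plus_fun_def)
  show "x \<otimes>\<^bsub>cycle_group G 2\<^esub> y = y \<otimes>\<^bsub>cycle_group G 2\<^esub> x"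
    by (simp add: cycle_group_def add.commute)
next
  fix x assume x: "x \<in> carrier (cycle_group G 2)"
  show "\<exists>y\<in>carrier (cycle_group G 2). y \<otimes>\<^bsub>cycle_group G 2\<^esub> x = \<one>\<^bsub>cycle_group G 2\<^esub>"
  proof (rule bexI)
    have "boundary G 2 (0 - x) = 0" and "0 - x \<in> chains G 2"
      using x chains_diff[OF chains_0] unfolding boundary_diff boundary_0
      by (auto simp: cycle_group_def cycles_def zero_fun_def[symmetric])
    then show "0 - x \<in> carrier (cycle_group G 2)"
      unfolding cycle_group_def cycles_def zero_fun_def[symmetric] by simp
  qed (simp add: cycle_group_def pointwise)
qed (auto simp: cycle_group_def cycles_def boundary_0[unfolded zero_fun_def] chains_0[unfolded zero_fun_def] add.assoc)

lemma subgroup_boundaries: "subgroup B2 (cycle_group G 2)"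
proof -
  interpret Z: comm_group "cycle_group G 2" by (rule comm_group_cycle_group)
  show ?thesis
  proof (rule Z.subgroupI)
    show "B2 \<subseteq> carrier (cycle_group G 2)" using B2_subset_cycles by (simp add: cycle_group_def)
    show "B2 \<noteq> {}" using B2_0 by blast
    fix a assume a: "a \<in> B2"
    have "inv\<^bsub>cycle_group G 2\<^esub> a = - a"
      by (rule Z.inv_equality) (use a B2_uminus[OF a] B2_subset_cycles in \<open>auto simp: cycle_group_def pointwise\<close>)
    then show "inv\<^bsub>cycle_group G 2\<^esub> a \<in> B2" using B2_uminus[OF a] by simp
    fix b assume b: "b \<in> B2"
    show "a \<otimes>\<^bsub>cycle_group G 2\<^esub> b \<in> B2"
      using B2_add[OF a b] by (simp add: cycle_group_def plus_fun_def)
  qed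
qed

lemma normal_boundaries: "B2 \<lhd> cycle_group G 2"
  by (rule comm_group.subgroup_imp_normal[OF comm_group_cycle_group subgroup_boundaries])

lemma group_schur_multiplier: "group (schur_multiplier G)"
  unfolding schur_multiplier_def group_homology_def
  by (rule normal.factorgroup_is_group[OF normal_boundaries])

lemma cycle_group_pow: "z [^]\<^bsub>cycle_group G 2\<^esub> (m::nat) = mul m z"
proof (induction m)
  case (Suc m)
  then show ?case unfolding mul_Suc2 by (simp add: cycle_group_def plus_fun_def nat_pow_def)
qed (simp add: cycle_group_def nat_pow_def zero_fun_def)

lemma schur_multiplier_pow:
  assumes "\<And>z. z \<in> cycles G 2 \<Longrightarrow> mul m z \<in> B2" and x: "x \<in> carrier (schur_multiplier G)"
  shows "x [^]\<^bsub>schur_multiplier G\<^esub> m = \<one>\<^bsub>schur_multiplier G\<^esub>"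
proof -
  let ?Z = "cycle_group G 2" and ?M = "cycle_group G 2 Mod B2"
  interpret Z: comm_group ?Z by (rule comm_group_cycle_group)
  interpret N: normal B2 ?Z by (rule normal_boundaries)
  interpret hom: group_hom ?Z ?M "\<lambda>a. B2 #>\<^bsub>?Z\<^esub> a"
    by (intro group_hom.intro group_hom_axioms.intro Z.group_axioms N.factorgroup_is_group N.r_coset_hom_Mod)
  obtain z where z: "z \<in> carrier ?Z" "x = B2 #>\<^bsub>?Z\<^esub> z"
    using x by (auto simp: schur_multiplier_def group_homology_def FactGroup_def RCOSETS_def)
  have "x [^]\<^bsub>?M\<^esub> m = B2 #>\<^bsub>?Z\<^esub> (z [^]\<^bsub>?Z\<^esub> m)"
    unfolding z(2) by (rule hom.hom_nat_pow[OF z(1), symmetric])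
  also have "\<dots> = B2"
  proof (rule Z.coset_join2[OF Z.nat_pow_closed[OF z(1)] subgroup_boundaries])
    show "z [^]\<^bsub>?Z\<^esub> m \<in> B2"
      unfolding cycle_group_pow by (rule assms(1)) (use z(1) in \<open>simp add: cycle_group_def\<close>)
  qed
  finally show ?thesis by (simp add: schur_multiplier_def group_homology_def FactGroup_def)
qed

end

text \<open>The remainder of \<open>m\<close> modulo the least exponent is again annihilating, hence
  0. Applied to \<open>G\<close> this makes the exponent a power of p; applied to the multiplier it
  turns annihilation into divisibility.\<close>

lemma (in group) group_exponent_props:
  assumes m: "0 < m" and all: "\<And>x. x \<in> carrier G \<Longrightarrow> x [^] m = \<one>"
  shows "group_exponent G dvd m" "0 < group_exponent G"
    "\<And>x. x \<in> carrier G \<Longrightarrow> x [^] group_exponent G = \<one>"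
proof -
  define Q where "Q n \<longleftrightarrow> 0 < n \<and> (\<forall>x\<in>carrier G. x [^] n = \<one>)" for n :: nat
  have Q: "Q m" using m all by (simp add: Q_def)
  have e: "group_exponent G = (LEAST n. Q n)"
    unfolding group_exponent_def Q_def by (rule if_P) (use Q Q_def in blast)
  have Qe: "Q (group_exponent G)" unfolding e using Q by (rule LeastI)
  then show "0 < group_exponent G" "\<And>x. x \<in> carrier G \<Longrightarrow> x [^] group_exponent G = \<one>"
    by (auto simp: Q_def)
  let ?e = "group_exponent G"
  have "x [^] (m mod ?e) = \<one>" if x: "x \<in> carrier G" for x
  proof -
    have "\<one> = x [^] (?e * (m div ?e) + m mod ?e)" using all[OF x] by simp
    also have "\<dots> = x [^] (m mod ?e)"
      unfolding nat_pow_mult[OF x, symmetric] nat_pow_pow[OF x, symmetric]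
      using x Qe by (simp add: Q_def)
    finally show ?thesis by simp
  qed
  moreover have "m mod ?e < ?e" using Qe by (simp add: Q_def)
  ultimately have "m mod ?e = 0"
    using not_less_Least[of "m mod ?e" Q] unfolding e[symmetric] by (auto simp: Q_def)
  then show "?e dvd m" by auto
qed

theorem theorem3p15:
  fixes p :: nat and G :: "('a, 'b) monoid_scheme"
  assumes "Factorial_Ring.prime p" and "odd p"
    and "group G" and "finite (carrier G)" and "p_group p G"
    and "nilpotency_class G 5"
  shows "group_exponent (schur_multiplier G) dvd group_exponent G"
proof -
  interpret finite_bar G
    using assms(3,4) by (simp add: finite_bar_def finite_bar_axioms_def)
  obtain k where k: "card (carrier G) = p ^ k" using assms(5) by (auto simp: p_group_def)
  have pk: "x [^]\<^bsub>G\<^esub> (p ^ k) = \<one>\<^bsub>G\<^esub>" if "x \<in> carrier G" for x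
    using pow_order_eq_1[OF that] k by (simp add: order_def)
  have "0 < p ^ k" using prime_gt_0_nat[OF assms(1)] by simp
  note exponent = group_exponent_props[OF this pk]
  then obtain n where n: "group_exponent G = p ^ n"
    using divides_primepow_nat[OF assms(1)] by blast
  have "lower_central G 5 = {\<one>\<^bsub>G\<^esub>}" using assms(6) by (simp add: nilpotency_class_def)
  then have "mul (group_exponent G) z \<in> boundaries G 2" if "z \<in> cycles G 2" for z
    using cycle_multiple_boundary[OF assms(1,2) _ _ that, of n] exponent(3) unfolding n by blast
  then show ?thesis
    by (intro group.group_exponent_props(1)[OF group_schur_multiplier exponent(2)] schur_multiplier_pow)
qed

end
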